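(* Let $G$ be a Coxeter group of type $I(n)$ for some $2\le n\le\infty$, let $\{g_1,g_2\}$ be a set of Coxeter generators, and let $\rho:G\to GL(V)$ be a finite dimensional unitary representation of $G$. (1) If $\rho':G\to GL(V')$ is another finite dimensional unitary representation of $G$ such that $\sigma_p(\rho(g_1),\rho(g_2))=\sigma_p(\rho'(g_1),\rho'(g_2))$ as subschemes of $\mathbb{C}^2$, then $\rho$ and $\rho'$ are equivalent. (2) If $\rho$ is irreducible then $\sigma_p(\rho(g_1),\rho(g_2))$ is reduced and irreducible.
   Context: The Coxeter group of type $I(n)$ with Coxeter generators $g_1,g_2$ is the dihedral group presented by $g_1^2=g_2^2=1$ and $(g_1g_2)^n=1$ (the last relation being omitted when $n=\infty$). A representation is unitary if it acts by unitary operators on a (here finite dimensional) complex Hilbert space. Two representations $\rho:G\to GL(V)$, $\rho':G\to GL(V')$ are equivalent if there is a linear isomorphism $C:V\to V'$ with $\rho'(w)=C\rho(w)C^{-1}$ for all $w\in G$. For linear operators $A_1,A_2$ on a finite dimensional complex vector space, the proper joint spectrum $\sigma_p(A_1,A_2)$ is the closed subscheme of $\mathbb{C}^2$ defined by the polynomial $\det(-I+x_1A_1+x_2A_2)$. Two such are equal as subschemes iff their defining polynomials agree up to a nonzero scalar; such a hypersurface is reduced and irreducible iff its defining polynomial is an irreducible polynomial. *)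

theory Defs
  imports
    "HOL-Library.Extended_Nat"
    "HOL-Algebra.Ideal"
    "HOL-Computational_Algebra.Field_as_Ring"
    "HOL-Computational_Algebra.Polynomial_Factorial"
    "Jordan_Normal_Form.Determinant"
begin

hide_const (open) Multiset.mult

section \<open>Group presentations and dihedral Coxeter groups\<close>

text \<open>A letter \<open>(x, True)\<close> stands for the generator \<open>x\<close> and \<open>(x, False)\<close> for its formal inverse.
  The classes of \<open>pres_eq R\<close> are the elements of the group presented by the relators \<open>R\<close>,
  i.e. of the free group modulo the normal closure of \<open>R\<close>.\<close>

type_synonym 'x word = "('x \<times> bool) list"

inductive pres_eq :: "'x word set \<Rightarrow> 'x word \<Rightarrow> 'x word \<Rightarrow> bool" for R :: "'x word set" where
  pres_refl: "pres_eq R u u"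
| pres_sym: "pres_eq R u v \<Longrightarrow> pres_eq R v u"
| pres_trans: "pres_eq R u v \<Longrightarrow> pres_eq R v w \<Longrightarrow> pres_eq R u w"
| pres_context: "pres_eq R u v \<Longrightarrow> pres_eq R (a @ u @ b) (a @ v @ b)"
| pres_cancel: "pres_eq R [(x, e), (x, \<not> e)] []"
| pres_relator: "r \<in> R \<Longrightarrow> pres_eq R r []"

primrec word_value :: "('g, 'm) monoid_scheme \<Rightarrow> ('x \<Rightarrow> 'g) \<Rightarrow> 'x word \<Rightarrow> 'g" where
  "word_value G \<gamma> [] = \<one>\<^bsub>G\<^esub>"
| "word_value G \<gamma> (l # w) =
     (if snd l then \<gamma> (fst l) else inv\<^bsub>G\<^esub> (\<gamma> (fst l))) \<otimes>\<^bsub>G\<^esub> word_value G \<gamma> w"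

definition presented_by :: "('g, 'm) monoid_scheme \<Rightarrow> ('x \<Rightarrow> 'g) \<Rightarrow> 'x word set \<Rightarrow> bool" where
  "presented_by G \<gamma> R \<longleftrightarrow> group G \<and> range \<gamma> \<subseteq> carrier G \<and>
     range (word_value G \<gamma>) = carrier G \<and>
     (\<forall>w. word_value G \<gamma> w = \<one>\<^bsub>G\<^esub> \<longleftrightarrow> pres_eq R w [])"

datatype dihedral_gen = S1 | S2

definition dihedral_relators :: "enat \<Rightarrow> dihedral_gen word set" where
  "dihedral_relators n =
     {[(S1, True), (S1, True)], [(S2, True), (S2, True)]} \<union>
     (case n of enat m \<Rightarrow> {concat (replicate m [(S1, True), (S2, True)])} | \<infinity> \<Rightarrow> {})"

definition coxeter_group_I :: "enat \<Rightarrow> ('g, 'm) monoid_scheme \<Rightarrow> 'g \<Rightarrow> 'g \<Rightarrow> bool" where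
  "coxeter_group_I n G g1 g2 \<longleftrightarrow>
     presented_by G (case_dihedral_gen g1 g2) (dihedral_relators n)"


section \<open>Unitary representations\<close>

text \<open>The underlying vector space is the whole type \<^typ>\<open>'v\<close>; the inner product is linear in its
  first argument. Completeness is automatic in finite dimension.\<close>

locale fd_hilbert_space = vector_space scale
  for scale :: "complex \<Rightarrow> 'v::ab_group_add \<Rightarrow> 'v" +
  fixes ip :: "'v \<Rightarrow> 'v \<Rightarrow> complex"
  assumes finite_dim: "\<exists>B. finite B \<and> span B = UNIV"
    and ip_add_left: "ip (x + y) z = ip x z + ip y z"
    and ip_scale_left: "ip (scale c x) y = c * ip x y"
    and ip_cnj: "ip y x = cnj (ip x y)"
    and ip_pos: "x \<noteq> 0 \<Longrightarrow> Re (ip x x) > 0"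

definition GL :: "(complex \<Rightarrow> 'v::ab_group_add \<Rightarrow> 'v) \<Rightarrow> ('v \<Rightarrow> 'v) monoid" where
  "GL scale = \<lparr>carrier = {A. Vector_Spaces.linear scale scale A \<and> bij A}, mult = (\<circ>), one = id\<rparr>"

definition unitary_rep ::
  "('g, 'm) monoid_scheme \<Rightarrow> (complex \<Rightarrow> 'v::ab_group_add \<Rightarrow> 'v) \<Rightarrow> ('v \<Rightarrow> 'v \<Rightarrow> complex) \<Rightarrow>
   ('g \<Rightarrow> 'v \<Rightarrow> 'v) \<Rightarrow> bool" where
  "unitary_rep G scale ip \<rho> \<longleftrightarrow> fd_hilbert_space scale ip \<and> \<rho> \<in> hom G (GL scale) \<and>
     (\<forall>w\<in>carrier G. \<forall>x y. ip (\<rho> w x) (\<rho> w y) = ip x y)"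

definition equivalent_reps ::
  "('g, 'm) monoid_scheme \<Rightarrow> (complex \<Rightarrow> 'v::ab_group_add \<Rightarrow> 'v) \<Rightarrow> ('g \<Rightarrow> 'v \<Rightarrow> 'v) \<Rightarrow>
   (complex \<Rightarrow> 'w::ab_group_add \<Rightarrow> 'w) \<Rightarrow> ('g \<Rightarrow> 'w \<Rightarrow> 'w) \<Rightarrow> bool" where
  "equivalent_reps G scale \<rho> scale' \<rho>' \<longleftrightarrow>
     (\<exists>C. Vector_Spaces.linear scale scale' C \<and> bij C \<and>
          (\<forall>w\<in>carrier G. \<rho>' w = C \<circ> \<rho> w \<circ> inv_into UNIV C))"

definition irreducible_rep ::
  "('g, 'm) monoid_scheme \<Rightarrow> (complex \<Rightarrow> 'v::ab_group_add \<Rightarrow> 'v) \<Rightarrow> ('g \<Rightarrow> 'v \<Rightarrow> 'v) \<Rightarrow> bool" where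
  "irreducible_rep G scale \<rho> \<longleftrightarrow> (\<exists>v::'v. v \<noteq> 0) \<and>
     (\<forall>W. module.subspace scale W \<and> (\<forall>w\<in>carrier G. \<rho> w ` W \<subseteq> W) \<longrightarrow> W = {0} \<or> W = UNIV)"


section \<open>Closed subschemes of the affine plane\<close>

text \<open>A polynomial in \<open>x\<^sub>1, x\<^sub>2\<close> is an element of \<^typ>\<open>complex poly poly\<close>; the outer variable is \<open>x\<^sub>2\<close>.\<close>

type_synonym poly2 = "complex poly poly"

definition X1 :: poly2 where "X1 = [:[:0, 1:]:]"
definition X2 :: poly2 where "X2 = [:0, 1:]"
definition const2 :: "complex \<Rightarrow> poly2" where "const2 c = [:[:c:]:]"

definition plane_ring :: "poly2 ring" where
  "plane_ring = \<lparr>carrier = UNIV, mult = (*), one = 1, zero = 0, add = (+)\<rparr>"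

text \<open>A closed subscheme of the plane is given by its ideal \<open>I\<close>; its points are the prime ideals
  containing \<open>I\<close>, and its closed subsets are the traces of the sets \<open>subscheme_points J\<close>.\<close>

definition subscheme_points :: "poly2 set \<Rightarrow> poly2 set set" where
  "subscheme_points I = {P. primeideal P plane_ring \<and> I \<subseteq> P}"

definition irreducible_subscheme :: "poly2 set \<Rightarrow> bool" where
  "irreducible_subscheme I \<longleftrightarrow> subscheme_points I \<noteq> {} \<and>
     (\<forall>J K. ideal J plane_ring \<and> ideal K plane_ring \<and>
        subscheme_points I \<subseteq> subscheme_points J \<union> subscheme_points K \<longrightarrow>
        subscheme_points I \<subseteq> subscheme_points J \<or> subscheme_points I \<subseteq> subscheme_points K)"

text \<open>No nonzero nilpotents in the coordinate ring:\<close>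

definition reduced_subscheme :: "poly2 set \<Rightarrow> bool" where
  "reduced_subscheme I \<longleftrightarrow> (\<forall>f k. f ^ k \<in> I \<longrightarrow> f \<in> I)"


section \<open>The proper joint spectrum\<close>

definition ordered_basis :: "(complex \<Rightarrow> 'v::ab_group_add \<Rightarrow> 'v) \<Rightarrow> 'v list \<Rightarrow> bool" where
  "ordered_basis scale bs \<longleftrightarrow> distinct bs \<and> \<not> module.dependent scale (set bs) \<and>
     module.span scale (set bs) = UNIV"

definition operator_mat ::
  "(complex \<Rightarrow> 'v::ab_group_add \<Rightarrow> 'v) \<Rightarrow> 'v list \<Rightarrow> ('v \<Rightarrow> 'v) \<Rightarrow> complex mat" where
  "operator_mat scale bs A = mat (length bs) (length bs)
     (\<lambda>(i, j). module.representation scale (set bs) (A (bs ! j)) (bs ! i))"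

definition pencil_det :: "complex mat \<Rightarrow> complex mat \<Rightarrow> poly2" where
  "pencil_det M1 M2 = det (- 1\<^sub>m (dim_row M1) + X1 \<cdot>\<^sub>m map_mat const2 M1 + X2 \<cdot>\<^sub>m map_mat const2 M2)"

text \<open>\<open>det (-I + x\<^sub>1 A\<^sub>1 + x\<^sub>2 A\<^sub>2)\<close>; the choice of the basis is immaterial,
  see \<open>joint_char_poly_eq\<close> below.\<close>

definition joint_char_poly ::
  "(complex \<Rightarrow> 'v::ab_group_add \<Rightarrow> 'v) \<Rightarrow> ('v \<Rightarrow> 'v) \<Rightarrow> ('v \<Rightarrow> 'v) \<Rightarrow> poly2" where
  "joint_char_poly scale A1 A2 =
     (let bs = SOME bs. ordered_basis scale bs
      in pencil_det (operator_mat scale bs A1) (operator_mat scale bs A2))"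

definition proper_joint_spectrum ::
  "(complex \<Rightarrow> 'v::ab_group_add \<Rightarrow> 'v) \<Rightarrow> ('v \<Rightarrow> 'v) \<Rightarrow> ('v \<Rightarrow> 'v) \<Rightarrow> poly2 set" where
  "proper_joint_spectrum scale A1 A2 = PIdl\<^bsub>plane_ring\<^esub> (joint_char_poly scale A1 A2)"


section \<open>Basis independence and hypersurfaces\<close>

lemma comm_ring_hom_const2: "comm_ring_hom const2"
  by unfold_locales (auto simp: const2_def one_pCons)

lemma ordered_basis_exists:
  assumes "fd_hilbert_space scale ip"
  shows "\<exists>bs. ordered_basis scale bs"
proof -
  interpret fd_hilbert_space scale ip by fact
  obtain B where B: "finite B" "span B = UNIV" using finite_dim by blast
  obtain B' where B': "B' \<subseteq> B" "independent B'" "span B' = span B"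
    using maximal_independent_subset[of B] span_minimal[OF _ subspace_span, of B]
    by (metis span_eq span_superset subset_trans)
  have "finite B'" using B' B finite_subset by blast
  then obtain bs where "set bs = B'" "distinct bs" using finite_distinct_list by blast
  thus ?thesis using B' B unfolding ordered_basis_def by auto
qed

lemma representation_sum_list:
  assumes "vector_space scale" "ordered_basis scale bs"
  shows "(\<Sum>i<length bs. scale (module.representation scale (set bs) v (bs ! i)) (bs ! i)) = v"
proof -
  interpret vector_space scale by fact
  have d: "distinct bs" and ind: "independent (set bs)" and sp: "span (set bs) = UNIV"
    using assms(2) unfolding ordered_basis_def by auto
  have "(\<Sum>b\<in>set bs. scale (representation (set bs) v b) b) = v"
    by (rule sum_representation_eq[OF ind]) (use sp in auto)
  moreover have "(\<Sum>i<length bs. scale (representation (set bs) v (bs ! i)) (bs ! i))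
      = (\<Sum>b\<in>set bs. scale (representation (set bs) v b) b)"
    by (rule sum.reindex_bij_betw[OF bij_betw_nth[OF d]]) auto
  ultimately show ?thesis by simp
qed

text \<open>\<open>trans_mat bs cs f\<close> is the matrix of \<open>f\<close> from the basis \<open>cs\<close> to the basis \<open>bs\<close>.\<close>

definition trans_mat where
  "trans_mat scale bs cs f = mat (length bs) (length cs)
     (\<lambda>(i, j). module.representation scale (set bs) (f (cs ! j)) (bs ! i))"

lemma trans_mat_mult:
  assumes lin: "Vector_Spaces.linear scale scale f"
    and bs: "ordered_basis scale bs" and cs: "ordered_basis scale cs"
  shows "trans_mat scale bs ds (f \<circ> g) = trans_mat scale bs cs f * trans_mat scale cs ds g"
proof (rule eq_matI)
  interpret f: Vector_Spaces.linear scale scale f by fact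
  have vs: "vector_space scale" by unfold_locales
  have ind: "f.vs1.independent (set bs)" and sp: "f.vs1.span (set bs) = UNIV"
    using bs unfolding ordered_basis_def by auto
  fix i j assume "i < dim_row (trans_mat scale bs cs f * trans_mat scale cs ds g)"
    and "j < dim_col (trans_mat scale bs cs f * trans_mat scale cs ds g)"
  hence i: "i < length bs" and j: "j < length ds" by (auto simp: trans_mat_def)
  let ?r = "f.vs1.representation"
  have "f (g (ds ! j)) = f (\<Sum>k<length cs. scale (?r (set cs) (g (ds ! j)) (cs ! k)) (cs ! k))"
    by (simp only: representation_sum_list[OF vs cs])
  also have "\<dots> = (\<Sum>k<length cs. scale (?r (set cs) (g (ds ! j)) (cs ! k)) (f (cs ! k)))"
    by (simp add: f.sum f.scale)
  finally have "?r (set bs) (f (g (ds ! j))) (bs ! i) =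
      ?r (set bs) (\<Sum>k<length cs. scale (?r (set cs) (g (ds ! j)) (cs ! k)) (f (cs ! k))) (bs ! i)"
    by simp
  also have "\<dots> = (\<Sum>k<length cs. ?r (set cs) (g (ds ! j)) (cs ! k) * ?r (set bs) (f (cs ! k)) (bs ! i))"
    using ind sp by (simp add: f.vs1.representation_sum f.vs1.representation_scale)
  finally show "trans_mat scale bs ds (f \<circ> g) $$ (i, j) =
      (trans_mat scale bs cs f * trans_mat scale cs ds g) $$ (i, j)"
    using i j by (simp add: trans_mat_def scalar_prod_def lessThan_atLeast0 mult.commute)
qed (auto simp: trans_mat_def)

lemma trans_mat_id:
  assumes "vector_space scale" "ordered_basis scale bs"
  shows "trans_mat scale bs bs id = 1\<^sub>m (length bs)"
proof -
  interpret vector_space scale by fact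
  show ?thesis using assms(2)
    by (intro eq_matI)
      (auto simp: trans_mat_def ordered_basis_def representation_basis nth_eq_iff_index_eq)
qed

lemma conj_pencil:
  fixes S T A B :: "'r::comm_ring_1 mat"
  assumes S: "S \<in> carrier_mat d d" and T: "T \<in> carrier_mat d d"
    and A: "A \<in> carrier_mat d d" and B: "B \<in> carrier_mat d d" and ST: "S * T = 1\<^sub>m d"
  shows "S * (- 1\<^sub>m d + x \<cdot>\<^sub>m A + y \<cdot>\<^sub>m B) * T
    = - 1\<^sub>m d + x \<cdot>\<^sub>m (S * A * T) + y \<cdot>\<^sub>m (S * B * T)"
proof -
  have one: "- 1\<^sub>m d \<in> carrier_mat d d" by simp
  have xA: "x \<cdot>\<^sub>m A \<in> carrier_mat d d" and yB: "y \<cdot>\<^sub>m B \<in> carrier_mat d d" using A B by auto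
  have oA: "- 1\<^sub>m d + x \<cdot>\<^sub>m A \<in> carrier_mat d d" using one xA by (intro add_carrier_mat) auto
  note c = mult_carrier_mat[OF S]
  have "S * (- 1\<^sub>m d + x \<cdot>\<^sub>m A + y \<cdot>\<^sub>m B) * T
      = (S * (- 1\<^sub>m d) + S * (x \<cdot>\<^sub>m A) + S * (y \<cdot>\<^sub>m B)) * T"
    using mult_add_distrib_mat[OF S oA yB] mult_add_distrib_mat[OF S one xA] by simp
  also have "\<dots> = S * (- 1\<^sub>m d) * T + S * (x \<cdot>\<^sub>m A) * T + S * (y \<cdot>\<^sub>m B) * T"
    using add_mult_distrib_mat[OF add_carrier_mat[OF c[OF xA]] c[OF yB] T]
      add_mult_distrib_mat[OF c[OF one] c[OF xA] T] by simp
  also have "S * (- 1\<^sub>m d) * T = - 1\<^sub>m d" using S T ST by simp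
  also have "S * (x \<cdot>\<^sub>m A) * T = x \<cdot>\<^sub>m (S * A * T)"
    using mult_smult_distrib[OF S A] mult_smult_assoc_mat[OF c[OF A] T] by simp
  also have "S * (y \<cdot>\<^sub>m B) * T = y \<cdot>\<^sub>m (S * B * T)"
    using mult_smult_distrib[OF S B] mult_smult_assoc_mat[OF c[OF B] T] by simp
  finally show ?thesis .
qed

lemma pencil_det_similar:
  assumes M: "M1 \<in> carrier_mat d d" "M2 \<in> carrier_mat d d"
    and P: "P \<in> carrier_mat d d" "Q \<in> carrier_mat d d" "P * Q = 1\<^sub>m d"
  shows "pencil_det (P * M1 * Q) (P * M2 * Q) = pencil_det M1 M2"
proof -
  interpret h: comm_ring_hom const2 by (rule comm_ring_hom_const2)
  define S T A B where "S = map_mat const2 P" and "T = map_mat const2 Q"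
    and "A = map_mat const2 M1" and "B = map_mat const2 M2"
  have c: "S \<in> carrier_mat d d" "T \<in> carrier_mat d d" "A \<in> carrier_mat d d" "B \<in> carrier_mat d d"
    using M P by (auto simp: S_def T_def A_def B_def)
  have ST: "S * T = 1\<^sub>m d"
    using h.mat_hom_mult[OF P(1,2)] by (simp add: S_def T_def P(3) h.mat_hom_one)
  have e: "map_mat const2 (P * M * Q) = S * map_mat const2 M * T" if "M \<in> carrier_mat d d" for M
    using h.mat_hom_mult[OF mult_carrier_mat[OF P(1) that] P(2)] h.mat_hom_mult[OF P(1) that]
    by (simp add: S_def T_def)
  define N where "N = - 1\<^sub>m d + X1 \<cdot>\<^sub>m A + X2 \<cdot>\<^sub>m B"
  have N: "N \<in> carrier_mat d d"
    using c unfolding N_def by (intro add_carrier_mat smult_carrier_mat)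
  have "pencil_det (P * M1 * Q) (P * M2 * Q) = det (S * N * T)"
    using P unfolding pencil_det_def N_def conj_pencil[OF c ST] e[OF M(1)] e[OF M(2)] A_def B_def
    by (simp add: conj_pencil[OF c ST, unfolded A_def B_def])
  also have "\<dots> = det S * det N * det T"
    using det_mult[OF mult_carrier_mat[OF c(1) N] c(2)] det_mult[OF c(1) N] by simp
  also have "\<dots> = det (S * T) * det N"
    using det_mult[OF c(1,2)] by (simp add: mult_ac)
  finally show ?thesis using M by (simp add: ST pencil_det_def N_def A_def B_def)
qed

lemma joint_char_poly_eq:
  assumes A: "Vector_Spaces.linear scale scale A1" "Vector_Spaces.linear scale scale A2"
    and bs: "ordered_basis scale bs"
  shows "joint_char_poly scale A1 A2 =
    pencil_det (operator_mat scale bs A1) (operator_mat scale bs A2)"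
proof -
  interpret Vector_Spaces.linear scale scale A1 by fact
  have vs: "vector_space scale" by unfold_locales
  define cs where "cs = (SOME cs. ordered_basis scale cs)"
  have cs: "ordered_basis scale cs" unfolding cs_def using bs by (rule someI)
  have id: "Vector_Spaces.linear scale scale id" by (rule vs1.linear_id)
  have len: "length cs = length bs"
  proof -
    have "card (set cs) = card (set bs)"
      using bs cs unfolding ordered_basis_def
      by (metis vs1.dim_eq_card_independent vs1.dim_span)
    thus ?thesis using bs cs unfolding ordered_basis_def by (simp add: distinct_card)
  qed
  have o: "operator_mat scale xs A = trans_mat scale xs xs A" for xs A
    unfolding operator_mat_def trans_mat_def ..
  define P Q where "P = trans_mat scale cs bs id" and "Q = trans_mat scale bs cs id"
  have "P * Q = 1\<^sub>m (length bs)"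
    unfolding P_def Q_def using trans_mat_mult[OF id cs bs, of cs id] trans_mat_id[OF vs cs] len
    by simp
  moreover have "operator_mat scale cs A = P * operator_mat scale bs A * Q"
    if "Vector_Spaces.linear scale scale A" for A
    unfolding o P_def Q_def
    using trans_mat_mult[OF id cs bs, of bs A] trans_mat_mult[OF that cs bs, of cs id] by simp
  moreover have "P \<in> carrier_mat (length bs) (length bs)" "Q \<in> carrier_mat (length bs) (length bs)"
    "operator_mat scale bs A \<in> carrier_mat (length bs) (length bs)" for A
    using len unfolding P_def Q_def trans_mat_def operator_mat_def by auto
  ultimately show ?thesis
    unfolding joint_char_poly_def Let_def cs_def[symmetric]
    using pencil_det_similar[of "operator_mat scale bs A1" "length bs" "operator_mat scale bs A2" P Q] A
    by simp
qed

lemma cring_plane_ring: "cring plane_ring"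
proof (rule cringI)
  show "abelian_group plane_ring"
    by (rule abelian_groupI) (auto simp: plane_ring_def add_ac intro: exI[of _ "- x" for x])
  show "comm_monoid plane_ring"
    by (rule comm_monoidI) (auto simp: plane_ring_def mult_ac)
qed (auto simp: plane_ring_def distrib_right)

lemma PIdl_plane_ring: "PIdl\<^bsub>plane_ring\<^esub> p = {q. p dvd q}"
  unfolding cgenideal_def plane_ring_def by (auto simp: dvd_def mult.commute)

lemma unit_poly2_iff: "is_unit (u :: poly2) \<longleftrightarrow> (\<exists>c. c \<noteq> 0 \<and> u = const2 c)"
  unfolding const2_def is_unit_poly_iff by (auto simp: is_unit_poly_iff dvd_field_iff)

lemma PIdl_eq_iff:
  "PIdl\<^bsub>plane_ring\<^esub> p = PIdl\<^bsub>plane_ring\<^esub> q \<longleftrightarrow> (\<exists>c. c \<noteq> 0 \<and> q = const2 c * p)"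
proof
  assume eq: "PIdl\<^bsub>plane_ring\<^esub> p = PIdl\<^bsub>plane_ring\<^esub> q"
  have "q \<in> {x. p dvd x}" "p \<in> {x. q dvd x}"
    unfolding eq[unfolded PIdl_plane_ring] by simp (simp flip: eq[unfolded PIdl_plane_ring])
  then obtain u v where u: "q = p * u" and v: "p = q * v" unfolding dvd_def by blast
  show "\<exists>c. c \<noteq> 0 \<and> q = const2 c * p"
  proof (cases "p = 0")
    case True
    hence "q = const2 1 * p" using u by simp
    thus ?thesis by (intro exI[of _ 1] conjI) (rule one_neq_zero)
  next
    case False
    have "p * (u * v) = q * v" unfolding mult.assoc[symmetric] u[symmetric] ..
    also have "\<dots> = p * 1" unfolding v[symmetric] by (rule mult_1_right[symmetric])
    finally have "1 = u * v" using False by simp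
    hence "is_unit u" by (rule dvdI)
    then obtain c where c: "c \<noteq> 0" "u = const2 c" unfolding unit_poly2_iff by blast
    have "q = const2 c * p" using u unfolding c(2) by (rule trans[OF _ mult.commute])
    with c(1) show ?thesis by blast
  qed
next
  assume "\<exists>c. c \<noteq> 0 \<and> q = const2 c * p"
  then obtain c where c: "c \<noteq> 0" "q = const2 c * p" by blast
  have "const2 (1 / c) * const2 c = 1" using c(1) by (simp add: const2_def one_pCons)
  hence "const2 (1 / c) * q = p" by (simp add: c(2) flip: mult.assoc)
  hence "q dvd p" by (intro dvdI[of p q "const2 (1 / c)"]) (simp add: mult.commute)
  moreover have "p dvd q" by (simp add: c(2))
  ultimately show "PIdl\<^bsub>plane_ring\<^esub> p = PIdl\<^bsub>plane_ring\<^esub> q"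
    unfolding PIdl_plane_ring by (intro Collect_cong) (blast intro: dvd_trans)
qed

lemma primeideal_PIdl:
  assumes "prime_elem p"
  shows "primeideal (PIdl\<^bsub>plane_ring\<^esub> p) plane_ring"
proof (rule primeidealI)
  show "ideal (PIdl\<^bsub>plane_ring\<^esub> p) plane_ring"
    using cring.cgenideal_ideal[OF cring_plane_ring] by (simp add: plane_ring_def)
  have "1 \<notin> PIdl\<^bsub>plane_ring\<^esub> p" using assms by (simp add: PIdl_plane_ring prime_elem_def)
  thus "carrier plane_ring \<noteq> PIdl\<^bsub>plane_ring\<^esub> p" by (auto simp: plane_ring_def)
  fix a b assume "a \<otimes>\<^bsub>plane_ring\<^esub> b \<in> PIdl\<^bsub>plane_ring\<^esub> p"
  hence "p dvd a * b" unfolding PIdl_plane_ring by (simp add: plane_ring_def)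
  thus "a \<in> PIdl\<^bsub>plane_ring\<^esub> p \<or> b \<in> PIdl\<^bsub>plane_ring\<^esub> p"
    using assms by (simp add: PIdl_plane_ring prime_elem_dvd_mult_iff)
qed (rule cring_plane_ring)

lemma integral_hypersurface:
  assumes "irreducible (p :: poly2)"
  shows "reduced_subscheme (PIdl\<^bsub>plane_ring\<^esub> p)" "irreducible_subscheme (PIdl\<^bsub>plane_ring\<^esub> p)"
proof -
  have p: "prime_elem p" using assms by (simp add: irreducible_imp_prime_elem)
  show "reduced_subscheme (PIdl\<^bsub>plane_ring\<^esub> p)"
    unfolding reduced_subscheme_def PIdl_plane_ring using p by (auto dest: prime_elem_dvd_power)
  have "PIdl\<^bsub>plane_ring\<^esub> p \<in> subscheme_points (PIdl\<^bsub>plane_ring\<^esub> p)"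
    using primeideal_PIdl[OF p] unfolding subscheme_points_def by simp
  thus "irreducible_subscheme (PIdl\<^bsub>plane_ring\<^esub> p)"
    unfolding irreducible_subscheme_def subscheme_points_def by blast
qed

end

theory Submission
  imports Defs "HOL-Computational_Algebra.Fundamental_Theorem_Algebra"
begin

text \<open>Write \<open>A = \<rho> g1\<close>, \<open>B = \<rho> g2\<close>. Since \<open>A\<^sup>2 = B\<^sup>2 = 1\<close>, the operator \<open>A B + B A\<close> commutes with
  \<open>A\<close> and \<open>B\<close>, so both preserve its eigenspaces. On the eigenspace for \<open>c\<close>, a fixed vector \<open>v\<close> of \<open>A\<close> generates
  an invariant plane with basis \<open>v, B v\<close> if \<open>c\<^sup>2 \<noteq> 4\<close>, and there is a common eigenvector if \<open>c\<^sup>2 = 4\<close>.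
  By unitarity, orthogonal complements are invariant, so the representation splits into such
  pieces. The characteristic polynomial of the pair is the product of those of the pieces, which are
  \<open>-1 + e x\<^sub>1 + f x\<^sub>2\<close> and \<open>1 - x\<^sub>1\<^sup>2 - c x\<^sub>1 x\<^sub>2 - x\<^sub>2\<^sup>2\<close>: they are irreducible and determine the piece, so unique
  factorization recovers the multiset of pieces.\<close>

section \<open>Irreducible blocks\<close>

text \<open>\<open>Quad c\<close> is the pair of operators on the plane with basis \<open>v, B v\<close>, where \<open>A v = v\<close> and
  \<open>A B + B A = c\<close>.\<close>

datatype block = Lin complex complex | Quad complex

text \<open>At c = 2 or c = -2 the polynomial of \<open>Quad c\<close> is 1 - (x1 + x2)^2 or 1 - (x1
  - x2)^2, a product of two linear factors. These values are excluded to keep every valid block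
  irreducible.\<close>

fun valid_block :: "block \<Rightarrow> bool" where
  "valid_block (Lin e f) \<longleftrightarrow> e\<^sup>2 = 1 \<and> f\<^sup>2 = 1"
| "valid_block (Quad c) \<longleftrightarrow> c\<^sup>2 \<noteq> 4"

fun block_mat1 :: "block \<Rightarrow> complex mat" where
  "block_mat1 (Lin e f) = mat_of_rows_list 1 [[e]]"
| "block_mat1 (Quad c) = mat_of_rows_list 2 [[1, c], [0, -1]]"

fun block_mat2 :: "block \<Rightarrow> complex mat" where
  "block_mat2 (Lin e f) = mat_of_rows_list 1 [[f]]"
| "block_mat2 (Quad c) = mat_of_rows_list 2 [[0, 1], [1, 0]]"

fun block_dim :: "block \<Rightarrow> nat" where
  "block_dim (Lin e f) = 1"
| "block_dim (Quad c) = 2"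

fun block_poly :: "block \<Rightarrow> poly2" where
  "block_poly (Lin e f) = [:[:-1, e:], [:f:]:]"
| "block_poly (Quad c) = [:[:1, 0, -1:], [:0, -c:], [:-1:]:]"

lemma block_mat_carrier:
  "block_mat1 t \<in> carrier_mat (block_dim t) (block_dim t)"
  "block_mat2 t \<in> carrier_mat (block_dim t) (block_dim t)"
  by (induction t) (auto intro!: carrier_matI simp: mat_of_rows_list_def)

lemma det_2x2:
  assumes A: "A \<in> carrier_mat 2 2"
  shows "det A = A $$ (0,0) * A $$ (1,1) - A $$ (0,1) * A $$ (1,0)"
proof -
  have "det (mat_delete A i 0) = A $$ (1 - i, 1)" if "i < 2" for i
    using A that by (subst det_single) (auto simp: mat_delete_def less_2_cases_iff)
  then show ?thesis
    by (subst laplace_expansion_column[OF A, of 0])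
      (auto simp: cofactor_def numeral_2_eq_2 mult.commute)
qed

lemma pencil_det_block: "pencil_det (block_mat1 t) (block_mat2 t) = block_poly t"
proof (cases t)
  case (Lin e f)
  show ?thesis unfolding pencil_det_def Lin
    by (subst det_single) (auto simp: mat_of_rows_list_def X1_def X2_def const2_def one_pCons)
next
  case (Quad c)
  show ?thesis unfolding pencil_det_def Quad
    by (subst det_2x2) (auto simp: mat_of_rows_list_def X1_def X2_def const2_def one_pCons)
qed

lemma pencil_det_four_block:
  assumes "M1 \<in> carrier_mat m m" "M2 \<in> carrier_mat m m"
    and "N1 \<in> carrier_mat k k" "N2 \<in> carrier_mat k k"
  shows "pencil_det (four_block_mat M1 (0\<^sub>m m k) (0\<^sub>m k m) N1)
      (four_block_mat M2 (0\<^sub>m m k) (0\<^sub>m k m) N2) = pencil_det M1 M2 * pencil_det N1 N2"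
proof -
  let ?P = "\<lambda>M1 M2. - 1\<^sub>m (dim_row M1) + X1 \<cdot>\<^sub>m map_mat const2 M1 + X2 \<cdot>\<^sub>m map_mat const2 M2"
  have "?P (four_block_mat M1 (0\<^sub>m m k) (0\<^sub>m k m) N1) (four_block_mat M2 (0\<^sub>m m k) (0\<^sub>m k m) N2) =
     four_block_mat (?P M1 M2) (0\<^sub>m m k) (0\<^sub>m k m) (?P N1 N2)"
    by (rule eq_matI) (use assms in \<open>auto simp: const2_def\<close>)
  then show ?thesis unfolding pencil_det_def
    using assms by (simp add: det_four_block_mat_lower_left_zero[of _ m _ k])
qed

lemma pencil_det_diag_block_mat:
  "pencil_det (diag_block_mat (map block_mat1 ts)) (diag_block_mat (map block_mat2 ts)) =
    prod_list (map block_poly ts)"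
proof (induction ts)
  case Nil
  then show ?case by (simp add: pencil_det_def)
next
  case (Cons t ts)
  define D where "D = sum_list (map block_dim ts)"
  have "dim_row (block_mat1 x) = block_dim x" "dim_col (block_mat1 x) = block_dim x"
    "dim_row (block_mat2 x) = block_dim x" "dim_col (block_mat2 x) = block_dim x" for x
    using block_mat_carrier[of x] by auto
  then have "diag_block_mat (map block_mat1 ts) \<in> carrier_mat D D"
    "diag_block_mat (map block_mat2 ts) \<in> carrier_mat D D"
    unfolding D_def by (auto intro!: carrier_matI simp: dim_diag_block_mat comp_def)
  then show ?case using Cons block_mat_carrier[of t]
    by (auto simp: Let_def pencil_det_four_block pencil_det_block)
qed

section \<open>Irreducibility of the block polynomials\<close>

lemma constant_factor_is_unit:
  fixes p u :: poly2
  assumes "u dvd p" "degree u = 0" "is_unit (lead_coeff p)"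
  shows "is_unit u"
proof -
  obtain v where v: "p = u * v" using assms(1) by (rule dvdE)
  obtain a where a: "u = [:a:]" using assms(2) by (rule degree_eq_zeroE)
  \<comment> \<open>A factor free of x2 divides every coefficient, in particular the leading one.
    Irreducibility thereby becomes a question about degrees in x2.\<close>
  have "is_unit (a * lead_coeff v)" using assms(3) unfolding v lead_coeff_mult a by simp
  then have "is_unit a" by (rule is_unit_mult_iff[THEN iffD1, THEN conjunct1])
  then show ?thesis unfolding a by (simp add: is_unit_const_poly_iff)
qed

lemma irreducible_block_poly_Lin:
  assumes "f \<noteq> 0"
  shows "irreducible (block_poly (Lin e f))"
proof (rule irreducibleI)
  let ?p = "block_poly (Lin e f)"
  show p0: "?p \<noteq> 0" and "\<not> is_unit ?p" using assms by (auto simp: is_unit_poly_iff)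
  fix u v assume uv: "?p = u * v"
  then have "u \<noteq> 0" "v \<noteq> 0" using p0 by auto
  then have "degree u + degree v = 1"
    using degree_mult_eq[of u v] assms unfolding uv[symmetric] by simp
  then have "degree u = 0 \<or> degree v = 0" by arith
  moreover have "is_unit (lead_coeff ?p)" using assms by (simp add: is_unit_const_poly_iff dvd_field_iff)
  ultimately show "is_unit u \<or> is_unit v"
    using constant_factor_is_unit[of u ?p] constant_factor_is_unit[of v ?p] uv by auto
qed

text \<open>A square root has degree at most 1, say a + b x. Then a^2 = 4 and 2 a b = 0 force b = 0,
  while d = b^2.\<close>

lemma square_eq_quadratic_poly:
  fixes s :: "complex poly"
  assumes "s\<^sup>2 = [:4, 0, d:]"
  shows "d = 0"
proof -
  have "2 * degree s = degree [:4, 0, d:]" using degree_power_eq[of s 2] unfolding assms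
    by (cases "s = 0") (use assms in auto)
  then have "degree s \<le> 1" by (auto split: if_splits)
  then have s: "s = [:coeff s 0, coeff s 1:]"
    by (intro poly_eqI) (auto simp: coeff_pCons coeff_eq_0 split: nat.splits)
  have "[:coeff s 0, coeff s 1:]\<^sup>2 = [:4, 0, d:]" using assms unfolding s[symmetric] .
  then show ?thesis by (auto simp: power2_eq_square)
qed

text \<open>With degree 2 and a unit leading coefficient in x2, the polynomial could only split
  properly into two factors of degree 1 in x2.\<close>

lemma irreducible_block_poly_Quad:
  assumes "c\<^sup>2 \<noteq> 4"
  shows "irreducible (block_poly (Quad c))"
proof (rule irreducibleI)
  let ?p = "block_poly (Quad c)"
  show p0: "?p \<noteq> 0" and "\<not> is_unit ?p" by (auto simp: is_unit_poly_iff)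
  fix u v assume uv: "?p = u * v"
  then have "u \<noteq> 0" "v \<noteq> 0" using p0 by auto
  then have deg: "degree u + degree v = 2"
    using degree_mult_eq[of u v] unfolding uv[symmetric] by simp
  have "degree u \<noteq> 1"
  proof
    assume "degree u = 1"
    then have "degree v = 1" using deg by simp
    obtain a0 a1 where u: "u = [:a0, a1:]" using degree1_coeffs[OF \<open>degree u = 1\<close>] .
    obtain b0 b1 where v: "v = [:b0, b1:]" using degree1_coeffs[OF \<open>degree v = 1\<close>] .
    have e: "a0 * b0 = [:1, 0, -1:]" "a0 * b1 + a1 * b0 = [:0, -c:]" "a1 * b1 = -1"
      using uv unfolding u v by (auto simp: algebra_simps one_pCons)
    txt \<open>The discriminant \<open>4 + (c\<^sup>2 - 4) x\<^sub>1\<^sup>2\<close> would have to be a square.\<close>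
    define s where "s = a0 * b1 - a1 * b0"
    have "s\<^sup>2 = (a0 * b1 + a1 * b0)\<^sup>2 - 4 * (a0 * b0) * (a1 * b1)"
      unfolding s_def by (simp add: power2_eq_square algebra_simps)
    also have "\<dots> = [:4, 0, c\<^sup>2 - 4:]"
      unfolding e by (simp add: power2_eq_square numeral_poly)
    finally show False using square_eq_quadratic_poly[of s "c\<^sup>2 - 4"] assms by simp
  qed
  then have "degree u = 0 \<or> degree v = 0" using deg by arith
  moreover have "is_unit (lead_coeff ?p)" by (simp add: is_unit_const_poly_iff)
  ultimately show "is_unit u \<or> is_unit v"
    using constant_factor_is_unit[of u ?p] constant_factor_is_unit[of v ?p] uv by auto
qed

lemma irreducible_block_poly:
  assumes "valid_block t"
  shows "irreducible (block_poly t)"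
proof (cases t)
  case (Lin e f)
  then have "f \<noteq> 0" using assms by auto
  then show ?thesis unfolding Lin by (rule irreducible_block_poly_Lin)
next
  case (Quad c)
  then have "c\<^sup>2 \<noteq> 4" using assms by simp
  then show ?thesis unfolding Quad by (rule irreducible_block_poly_Quad)
qed

section \<open>Recovering the blocks by unique factorization\<close>

lemma block_poly_dvd_imp_eq:
  assumes "valid_block t" "valid_block t'" "block_poly t dvd block_poly t'"
  shows "t = t'"
proof -
  have "block_poly t' dvd block_poly t"
    using irreducibleD'[OF irreducible_block_poly[OF assms(2)] assms(3)]
      irreducible_block_poly[OF assms(1)] by (auto simp: irreducible_def)
  then have "PIdl\<^bsub>plane_ring\<^esub> (block_poly t) = PIdl\<^bsub>plane_ring\<^esub> (block_poly t')"
    using assms(3) unfolding PIdl_plane_ring by (intro Collect_cong) (blast intro: dvd_trans)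
  \<comment> \<open>The degree in x2 separates the two kinds of block. Within one kind the constant
    terms agree (-1 for \<open>Lin\<close>, 1 for \<open>Quad\<close>), so k = 1 and the remaining
    coefficients give the parameters.\<close>
  then obtain k where k: "k \<noteq> 0" "block_poly t' = const2 k * block_poly t"
    unfolding PIdl_eq_iff by blast
  then show ?thesis using assms(1,2)
    by (cases t; cases t') (auto simp: const2_def split: if_splits)
qed

text \<open>Unique factorization with multiplicities: the prime \<open>f x\<close> divides the
  product over \<open>ys\<close>, hence some \<open>f y\<close>, and then x = y. Cancelling this
  factor on both sides leaves a shorter list.\<close>

lemma mset_subset_if_prod_dvd:
  fixes f :: "'a \<Rightarrow> 'b::idom"
  assumes prime: "\<And>x. P x \<Longrightarrow> prime_elem (f x)"
    and eq: "\<And>x y. P x \<Longrightarrow> P y \<Longrightarrow> f x dvd f y \<Longrightarrow> x = y"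
  shows "\<forall>x\<in>set xs. P x \<Longrightarrow> \<forall>y\<in>set ys. P y \<Longrightarrow>
    prod_list (map f xs) dvd prod_list (map f ys) \<Longrightarrow> mset xs \<subseteq># mset ys"
proof (induction xs arbitrary: ys)
  case (Cons x xs)
  have p: "prime_elem (f x)" using Cons prime by simp
  have Px: "P x" using Cons.prems by simp
  have "x \<in> set zs" if "f x dvd prod_list (map f zs)" "\<forall>y\<in>set zs. P y" for zs
    using that
  proof (induction zs)
    case Nil
    then show ?case using p by (simp add: prime_elem_def)
  next
    case (Cons y zs)
    then show ?case using eq[OF Px, of y] p
      by (auto simp: prime_elem_dvd_mult_iff)
  qed
  moreover have "f x dvd prod_list (map f ys)"
    using Cons.prems(3) dvd_mult_left[of "f x" "prod_list (map f xs)"] by simp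
  ultimately have x: "x \<in> set ys" using Cons.prems by blast
  have "prod_list (map f ys) = f x * prod_list (map f (remove1 x ys))"
    using x by (induction ys) (auto simp: mult_ac)
  then have "prod_list (map f xs) dvd prod_list (map f (remove1 x ys))"
    using Cons.prems(3) p by (simp add: prime_elem_def)
  then have "mset xs \<subseteq># mset (remove1 x ys)"
    using Cons.prems by (intro Cons.IH) (auto dest: notin_set_remove1 set_remove1_subset[THEN subsetD])
  then show ?case using x by (simp add: insert_subset_eq_iff)
qed auto

lemma mset_blocks_eq:
  assumes ts: "\<forall>t\<in>set ts. valid_block t" and ts': "\<forall>t\<in>set ts'. valid_block t"
    and eq: "PIdl\<^bsub>plane_ring\<^esub> (prod_list (map block_poly ts)) =
      PIdl\<^bsub>plane_ring\<^esub> (prod_list (map block_poly ts'))"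
  shows "mset ts = mset ts'"
proof (rule subset_mset.antisym)
  have prime: "prime_elem (block_poly t)" if "valid_block t" for t
    using irreducible_block_poly[OF that] by (rule irreducible_imp_prime_elem)
  have sub: "mset xs \<subseteq># mset ys"
    if "\<forall>t\<in>set xs. valid_block t" "\<forall>t\<in>set ys. valid_block t"
      "PIdl\<^bsub>plane_ring\<^esub> (prod_list (map block_poly xs)) =
        PIdl\<^bsub>plane_ring\<^esub> (prod_list (map block_poly ys))" for xs ys
  proof (rule mset_subset_if_prod_dvd[where P = valid_block and f = block_poly])
    show "prod_list (map block_poly xs) dvd prod_list (map block_poly ys)"
      using that(3) unfolding PIdl_plane_ring set_eq_iff mem_Collect_eq by (metis dvd_refl)
  qed (fact prime block_poly_dvd_imp_eq that(1,2))+
  show "mset ts \<subseteq># mset ts'" "mset ts' \<subseteq># mset ts" by (intro sub ts ts' eq eq[symmetric])+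
qed

section \<open>Projections and eigenvectors\<close>

context fd_hilbert_space
begin

lemma ip_zero_left [simp]: "ip 0 x = 0"
  using ip_scale_left[of 0 0 x] by simp

lemma ip_diff_left: "ip (x - y) z = ip x z - ip y z"
  using ip_add_left[of "x - y" y z] by simp

lemma ip_add_right: "ip z (x + y) = ip z x + ip z y"
  using ip_cnj[of z "x + y"] ip_cnj[of z x] ip_cnj[of z y] by (simp add: ip_add_left)

lemma ip_scale_right: "ip x (scale c y) = cnj c * ip x y"
  using ip_cnj[of x "scale c y"] ip_cnj[of x y] by (simp add: ip_scale_left)

lemma ip_zero_right [simp]: "ip x 0 = 0"
  using ip_scale_right[of x 0 0] by simp

lemma ip_self_eq_0_iff [simp]: "ip x x = 0 \<longleftrightarrow> x = 0"
  using ip_pos[of x] by force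

lemma orthogonal_span:
  assumes "\<And>s. s \<in> S \<Longrightarrow> ip y s = 0" and "w \<in> span S"
  shows "ip y w = 0"
proof -
  have "subspace {w. ip y w = 0}"
    by (auto simp: subspace_def ip_add_right ip_scale_right)
  then have "span S \<subseteq> {w. ip y w = 0}" using assms(1) by (intro span_minimal) auto
  then show ?thesis using assms(2) by auto
qed

text \<open>One Gram-Schmidt step per vector: a - a0 is the part of \<open>a\<close> orthogonal to
  the old span, and the old projection x0 is corrected by the component k of x - x0 along a -
  a0.\<close>

lemma orthogonal_projection_exists:
  assumes "finite S"
  shows "\<exists>u\<in>span S. \<forall>w\<in>span S. ip (x - u) w = 0"
  using assms
proof (induction S arbitrary: x)
  case empty
  then show ?case by auto
next
  case (insert a S)
  obtain a0 where a0: "a0 \<in> span S" "\<And>w. w \<in> span S \<Longrightarrow> ip (a - a0) w = 0"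
    using insert.IH by blast
  obtain x0 where x0: "x0 \<in> span S" "\<And>w. w \<in> span S \<Longrightarrow> ip (x - x0) w = 0"
    using insert.IH by blast
  show ?case
  proof (cases "a - a0 = 0")
    case True
    then have "span (insert a S) = span S" using a0(1) by (intro span_redundant) simp
    then show ?thesis using x0 by auto
  next
    case False
    define k u where "k = ip (x - x0) (a - a0) / ip (a - a0) (a - a0)"
      and "u = x0 + scale k (a - a0)"
    have sub: "span S \<subseteq> span (insert a S)" by (intro span_mono) auto
    have "u \<in> span (insert a S)"
      unfolding u_def using x0(1) a0(1) sub by (intro span_add span_scale span_diff) (auto intro: span_base)
    moreover have "ip (x - u) w = 0" if w: "w \<in> span (insert a S)" for w
    proof (rule orthogonal_span[OF _ w])
      have S: "ip (x - u) s = 0" if "s \<in> span S" for s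
        using x0(2)[OF that] a0(2)[OF that]
        by (simp add: u_def ip_add_left ip_diff_left ip_scale_left)
      have "ip (x - u) (a - a0) = 0"
        using False by (simp add: u_def k_def diff_diff_add[symmetric] ip_diff_left[of "x - x0"] ip_scale_left)
      then have "ip (x - u) a = 0"
        using S[OF a0(1)] ip_add_right[of "x - u" "a - a0" a0] by simp
      then show "ip (x - u) s = 0" if "s \<in> insert a S" for s
        using that S span_base by auto
    qed
    ultimately show ?thesis by blast
  qed
qed

end

section \<open>Eigenvectors inside an invariant subspace\<close>

locale fd_operator = fd_hilbert_space scale ip + f: Vector_Spaces.linear scale scale f
  for scale :: "complex \<Rightarrow> 'v::ab_group_add \<Rightarrow> 'v" and ip f
begin

definition poly_act :: "complex poly \<Rightarrow> 'v \<Rightarrow> 'v" where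
  "poly_act p v = (\<Sum>i\<le>degree p. scale (coeff p i) ((f ^^ i) v))"

lemma poly_act_altdef:
  assumes "degree p \<le> n"
  shows "poly_act p v = (\<Sum>i\<le>n. scale (coeff p i) ((f ^^ i) v))"
  unfolding poly_act_def using assms
  by (intro sum.mono_neutral_left) (auto simp: coeff_eq_0)

text \<open>Multiplication by the variable shifts the coefficients, which amounts to one more
  application of f. Both sums run up to \<open>Suc n\<close> so that they can be subtracted term by
  term.\<close>

lemma poly_act_linear_factor:
  "poly_act ([:-a, 1:] * q) v = f (poly_act q v) - scale a (poly_act q v)"
proof -
  define n where "n = degree q"
  have e: "[:-a, 1:] * q = pCons 0 q - smult a q" by simp
  have "poly_act ([:-a, 1:] * q) v = (\<Sum>i\<le>Suc n. scale (coeff (pCons 0 q - smult a q) i) ((f ^^ i) v))"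
    unfolding e by (rule poly_act_altdef)
      (auto simp: n_def intro!: degree_diff_le order_trans[OF degree_smult_le])
  also have "\<dots> = (\<Sum>i\<le>Suc n. scale (coeff (pCons 0 q) i) ((f ^^ i) v)) -
      (\<Sum>i\<le>Suc n. scale a (scale (coeff q i) ((f ^^ i) v)))"
    by (simp add: scale_left_diff_distrib sum_subtractf)
  also have "(\<Sum>i\<le>Suc n. scale (coeff (pCons 0 q) i) ((f ^^ i) v)) = f (poly_act q v)"
    by (subst sum.atMost_Suc_shift) (simp add: poly_act_def n_def f.sum f.scale)
  also have "(\<Sum>i\<le>Suc n. scale a (scale (coeff q i) ((f ^^ i) v))) = scale a (poly_act q v)"
    by (subst poly_act_altdef[of q "Suc n"]) (auto simp: n_def scale_sum_right simp del: sum.atMost_Suc)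
  finally show ?thesis .
qed

text \<open>A linear relation among the iterates of v is an equation p(f) v = 0. If only p = 0
  satisfied it, the iterates would form an infinite independent set, against finite
  dimension.\<close>

lemma annihilating_poly_exists: "\<exists>p. p \<noteq> 0 \<and> poly_act p v = 0"
proof (rule ccontr)
  assume contra: "\<not> ?thesis"
  have indep: "c i = 0" if I: "finite I" "(\<Sum>i\<in>I. scale (c i) ((f ^^ i) v)) = 0" "i \<in> I" for c I i
  proof -
    define p where "p = (\<Sum>i\<in>I. monom (c i) i)"
    have co: "coeff p j = (if j \<in> I then c j else 0)" for j
      unfolding p_def using I(1) by (simp add: coeff_sum coeff_monom sum.delta')
    have "poly_act p v = (\<Sum>i\<le>max (degree p) (Max I). scale (coeff p i) ((f ^^ i) v))"
      by (rule poly_act_altdef) simp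
    also have "\<dots> = (\<Sum>i\<in>I. scale (coeff p i) ((f ^^ i) v))"
      using I(1) by (intro sum.mono_neutral_right) (auto simp: co le_max_iff_disj)
    also have "\<dots> = 0" using I(2) by (simp add: co)
    finally have "p = 0" using contra by blast
    then show ?thesis using co[of i] I(3) by simp
  qed
  \<comment> \<open>Distinctness needs its own argument, since independence of the set of iterates
    does not exclude repetitions. A repetition is a relation with coefficients 1 and -1.\<close>
  have inj: "inj (\<lambda>i. (f ^^ i) v)"
  proof (rule injI, rule ccontr)
    fix i j assume "(f ^^ i) v = (f ^^ j) v" "i \<noteq> j"
    then show False using indep[of "{i, j}" "\<lambda>k. if k = i then 1 else -1" i] by simp
  qed
  have "independent (range (\<lambda>i. (f ^^ i) v))"
    unfolding independent_explicit_finite_subsets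
  proof (intro allI impI ballI)
    fix S u x assume S: "S \<subseteq> range (\<lambda>i. (f ^^ i) v)" "finite S" "(\<Sum>v\<in>S. scale (u v) v) = 0" "x \<in> S"
    then obtain I where I: "S = (\<lambda>i. (f ^^ i) v) ` I" "finite I"
      using finite_subset_image[OF S(2,1)] by auto
    obtain i where i: "i \<in> I" "x = (f ^^ i) v" using S(4) unfolding I(1) by auto
    have "(\<Sum>i\<in>I. scale (u ((f ^^ i) v)) ((f ^^ i) v)) = 0"
      using S(3) unfolding I(1) by (simp add: sum.reindex[OF inj_on_subset[OF inj]])
    then show "u x = 0" using indep[of I "\<lambda>i. u ((f ^^ i) v)" i] I(2) i by simp
  qed
  moreover obtain T where "finite T" "span T = UNIV" using finite_dim by blast
  ultimately have "finite (range (\<lambda>i. (f ^^ i) v))" using independent_span_bound by blast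
  then show False using inj finite_imageD by blast
qed

text \<open>Linear factors are peeled off an annihilating polynomial of v. If p = (x - a) q, then
  either q already annihilates v, or q(f) v is an eigenvector for a. It lies in W, as do all
  iterates of v.\<close>

lemma eigenvector_exists:
  assumes W: "subspace W" "\<And>x. x \<in> W \<Longrightarrow> f x \<in> W" and v: "v \<in> W" "v \<noteq> 0"
  shows "\<exists>w a. w \<in> W \<and> w \<noteq> 0 \<and> f w = scale a w"
proof -
  have pow: "(f ^^ i) v \<in> W" for i using v W by (induction i) auto
  have "\<exists>w a. w \<in> W \<and> w \<noteq> 0 \<and> f w = scale a w" if "p \<noteq> 0" "poly_act p v = 0" for p
    using that
  proof (induction "degree p" arbitrary: p)
    case 0
    then obtain a where a: "p = [:a:]" by (metis degree_eq_zeroE)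
    then show ?case using 0 v by (simp add: poly_act_def)
  next
    case (Suc n)
    then have "\<not> constant (poly p)" by (simp add: constant_degree)
    then obtain a where "poly p a = 0" using fundamental_theorem_of_algebra by blast
    then obtain q where q: "p = [:-a, 1:] * q" unfolding poly_eq_0_iff_dvd by (rule dvdE)
    have "q \<noteq> 0" using Suc q by auto
    then have "n = degree q" using Suc(2) unfolding q by (simp add: degree_mult_eq del: mult_pCons_left)
    show ?case
    proof (cases "poly_act q v = 0")
      case True
      then show ?thesis using Suc(1) \<open>n = degree q\<close> \<open>q \<noteq> 0\<close> by blast
    next
      case False
      have "f (poly_act q v) = scale a (poly_act q v)"
        using Suc(4) unfolding q poly_act_linear_factor by simp
      moreover have "poly_act q v \<in> W"
        unfolding poly_act_def by (intro subspace_sum subspace_scale W pow)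
      ultimately show ?thesis using False by blast
    qed
  qed
  then show ?thesis using annihilating_poly_exists by blast
qed

end

section \<open>Decomposition of a pair of unitary involutions\<close>

fun block_basis :: "('v \<Rightarrow> 'v) \<Rightarrow> block \<times> 'v \<Rightarrow> 'v list" where
  "block_basis B (Lin e f, v) = [v]"
| "block_basis B (Quad c, v) = [v, B v]"

locale involution_pair = fd_hilbert_space scale ip
    + A: Vector_Spaces.linear scale scale A + B: Vector_Spaces.linear scale scale B
  for scale :: "complex \<Rightarrow> 'v::ab_group_add \<Rightarrow> 'v" and ip A B +
  assumes A_A [simp]: "A (A x) = x" and B_B [simp]: "B (B x) = x"
    and ip_A: "ip (A x) (A y) = ip x y" and ip_B: "ip (B x) (B y) = ip x y"
begin

text \<open>In the \<open>Quad\<close> case the first two conditions make v and B v independent. The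
  last equation is A B + B A = c evaluated at the fixed vector v of A.\<close>

fun spans_block :: "block \<times> 'v \<Rightarrow> bool" where
  "spans_block (Lin e f, v) \<longleftrightarrow> v \<noteq> 0 \<and> A v = scale e v \<and> B v = scale f v"
| "spans_block (Quad c, v) \<longleftrightarrow> (\<forall>k. B v \<noteq> scale k v) \<and> v \<noteq> 0 \<and> A v = v \<and>
     A (B v) = scale c v - B v"

lemma span_invariant:
  assumes "\<forall>x\<in>S. A x \<in> span S \<and> B x \<in> span S"
  shows "A ` span S \<subseteq> span S" "B ` span S \<subseteq> span S"
proof -
  have "A ` S \<subseteq> span S" "B ` S \<subseteq> span S" using assms by auto
  then show "A ` span S \<subseteq> span S" "B ` span S \<subseteq> span S"
    unfolding A.span_image[symmetric] B.span_image[symmetric] by (simp_all add: span_minimal)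
qed

lemma span_block_invariant:
  assumes "spans_block p"
  shows "A ` span (set (block_basis B p)) \<subseteq> span (set (block_basis B p))"
    "B ` span (set (block_basis B p)) \<subseteq> span (set (block_basis B p))"
proof -
  obtain t v where p: "p = (t, v)" by (cases p)
  have "\<forall>x\<in>set (block_basis B p). A x \<in> span (set (block_basis B p)) \<and> B x \<in> span (set (block_basis B p))"
    using assms unfolding p by (cases t) (auto simp: span_scale span_diff span_base)
  then show "A ` span (set (block_basis B p)) \<subseteq> span (set (block_basis B p))"
    "B ` span (set (block_basis B p)) \<subseteq> span (set (block_basis B p))"
    by (rule span_invariant)+
qed

text \<open>W will be the orthogonal complement of the span of \<open>bs\<close>. If B v were in the
  span of v and \<open>bs\<close>, some B v - k v would lie in that span and in W, hence vanish,
  contradicting \<open>spans_block\<close>.\<close>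

lemma independent_append_block:
  assumes p: "spans_block p" and W: "subspace W" "set (block_basis B p) \<subseteq> W"
    and disj: "span (set bs) \<inter> W = {0}" and bs: "distinct bs" "independent (set bs)"
  shows "distinct (block_basis B p @ bs)" "independent (set (block_basis B p @ bs))"
proof -
  obtain t v where tv: "p = (t, v)" by (cases p)
  have v: "v \<in> W" "v \<noteq> 0" using p W(2) unfolding tv by (cases t; auto)+
  have v_notin: "v \<notin> span (set bs)" using v disj by auto
  have "distinct (block_basis B p @ bs) \<and> independent (set (block_basis B p @ bs))"
  proof (cases t)
    case (Lin e f)
    then show ?thesis unfolding tv using bs v_notin
      by (auto simp: independent_insert intro: span_base)
  next
    case (Quad c)
    have "B v \<notin> span (insert v (set bs))"
    proof
      assume "B v \<in> span (insert v (set bs))"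
      then obtain k where k: "B v - scale k v \<in> span (set bs)" unfolding span_insert by auto
      have "B v - scale k v \<in> W"
        using W v unfolding tv Quad by (auto intro!: subspace_diff subspace_scale)
      then have "B v - scale k v = 0" using k disj by blast
      then show False using p unfolding tv Quad by simp
    qed
    then have "distinct (B v # v # bs)" "independent (insert (B v) (insert v (set bs)))"
      using bs v_notin by (auto simp: independent_insert intro: span_base)
    then show ?thesis unfolding tv Quad by (auto simp: insert_commute)
  qed
  then show "distinct (block_basis B p @ bs)" "independent (set (block_basis B p @ bs))" by auto
qed

lemma block_in_invariant_subspace:
  assumes W: "subspace W" "\<And>x. x \<in> W \<Longrightarrow> A x \<in> W" "\<And>x. x \<in> W \<Longrightarrow> B x \<in> W" and "W \<noteq> {0}"
  shows "\<exists>p. valid_block (fst p) \<and> spans_block p \<and> set (block_basis B p) \<subseteq> W"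
proof -
  define C where "C = (\<lambda>x. A (B x) + B (A x))"
  interpret C: fd_operator scale ip C
    unfolding C_def by unfold_locales (simp_all add: A.add B.add A.scale B.scale scale_right_distrib)
  obtain v where "v \<in> W" "v \<noteq> 0" using assms(4) subspace_0[OF W(1)] by blast
  moreover have "C x \<in> W" if "x \<in> W" for x
    unfolding C_def using W that by (intro subspace_add) auto
  ultimately obtain u c where u: "u \<in> W" "u \<noteq> 0" "C u = scale c u"
    using C.eigenvector_exists[OF W(1)] by blast
  define E where "E = {x \<in> W. C x = scale c x}"
  have uE: "u \<in> E" using u by (simp add: E_def)
  have AE: "A x \<in> E" and BE: "B x \<in> E" if "x \<in> E" for x
  proof -
    have x: "x \<in> W" "A (B x) + B (A x) = scale c x" using that by (auto simp: E_def C_def)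
    \<comment> \<open>Applying A and B to the eigenvalue equation of x gives those of A x and B x,
      because both operators are involutions.\<close>
    have "A (B (A x)) + B x = A (scale c x)" "A x + B (A (B x)) = B (scale c x)"
      using x(2)[symmetric] by (auto simp: A.add B.add)
    then show "A x \<in> E" "B x \<in> E" using x W by (auto simp: E_def C_def A.scale B.scale add.commute)
  qed
  have E: "subspace E"
    unfolding subspace_def E_def
    by (auto simp: C.f.add C.f.scale scale_right_distrib scale_left_commute
        intro: subspace_add[OF W(1)] subspace_scale[OF W(1)] subspace_0[OF W(1)])
  show ?thesis
  proof (cases "c\<^sup>2 = 4")
    case False
    \<comment> \<open>Otherwise A = -1 on E, hence C = -2 B there, and applying C twice to u gives
      c^2 = 4.\<close>
    have "\<exists>x\<in>E. x + A x \<noteq> 0"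
    proof (rule ccontr)
      assume "\<not> ?thesis"
      then have neg: "A x = - x" if "x \<in> E" for x using that by (auto simp: add_eq_0_iff)
      have "scale c u = - (B u + B u)"
        using u(3) neg[OF uE] neg[OF BE[OF uE]] by (simp add: C_def B.neg)
      then have cu: "scale c u = scale (-2) (B u)"
        using scale_left_distrib[of 1 1 "B u"] by simp
      have cB: "scale c (B u) = scale (-2) u"
        using arg_cong[OF cu, of B] by (simp only: B.scale B_B)
      have "scale (c * c) u = scale c (scale (-2) (B u))" using cu by (simp flip: scale_scale)
      also have "\<dots> = scale (-2) (scale c (B u))" by (rule scale_left_commute)
      also have "\<dots> = scale 4 u" unfolding cB by simp
      finally have "scale (c * c - 4) u = 0" by (simp add: scale_left_diff_distrib)
      then show False using False u(2) by (simp add: power2_eq_square)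
    qed
    then obtain x where x: "x \<in> E" "x + A x \<noteq> 0" by blast
    define v where "v = x + A x"
    have v: "v \<in> E" "v \<noteq> 0" "A v = v"
      using x AE E by (auto simp: v_def A.add add.commute intro: subspace_add)
    have ABv: "A (B v) = scale c v - B v"
      using v(1,3) by (simp add: E_def C_def algebra_simps)
    \<comment> \<open>If v were an eigenvector of B, its eigenvalue k would satisfy k^2 = 1 and c =
      2 k, so again c^2 = 4.\<close>
    have "B v \<noteq> scale k v" for k
    proof
      assume k: "B v = scale k v"
      have "v = scale k (scale k v)" using B_B[of v] unfolding k B.scale by simp
      then have "scale (k * k - 1) v = 0" by (simp add: scale_left_diff_distrib)
      then have k2: "k * k = 1" using v(2) by simp
      have "scale c v = scale (k + k) v"
        using ABv unfolding k A.scale v(3) scale_left_distrib by (simp add: eq_diff_eq)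
      then have "c = 2 * k" using v(2) by simp
      then show False using False k2 by (simp add: power2_eq_square)
    qed
    then have "spans_block (Quad c, v)" using v ABv by simp
    moreover have "set (block_basis B (Quad c, v)) \<subseteq> W" using v(1) BE by (auto simp: E_def)
    ultimately show ?thesis using False by (intro exI[of _ "(Quad c, v)"]) simp
  next
    case True
    define e where "e = c / 2"
    have e: "e * e = 1" "c = 2 * e" using True by (auto simp: e_def power2_eq_square)
    have "\<exists>x\<in>E. x \<noteq> 0 \<and> B x = scale e (A x)"
    proof (cases "B u = scale e (A u)")
      case False
      txt \<open>\<open>(B - e A)\<^sup>2 = 2 - e (A B + B A)\<close> vanishes on \<open>E\<close>, so \<open>B - e A\<close> maps \<open>u\<close> into its own kernel.\<close>
      define y where "y = B u - scale e (A u)"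
      have y: "y \<in> E" unfolding y_def using AE BE uE E by (intro subspace_diff subspace_scale) auto
      have "scale e (A (B u)) + scale e (B (A u)) = scale e (scale c u)"
        using u(3) unfolding C_def by (simp flip: scale_right_distrib)
      also have "\<dots> = scale (1 + 1) u" using e by simp
      also have "\<dots> = u + u" unfolding scale_left_distrib by simp
      finally have "B y = scale e (A y)"
        using e(1) by (simp add: y_def A.diff B.diff A.scale B.scale algebra_simps)
      moreover have "y \<noteq> 0" unfolding y_def using False by simp
      ultimately show ?thesis using y by blast
    qed (use uE u in auto)
    then obtain x where x: "x \<in> E" "x \<noteq> 0" "B x = scale e (A x)" by blast
    have "A x = scale e (B x)" unfolding x(3) using e(1) by simp
    then have BAx: "B (A x) = scale e x" by (metis B.scale B_B)
    \<comment> \<open>If x + A x vanishes, x itself is an eigenvector of A with d = -1. Otherwise x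
      + A x is one with d = 1. In both cases B acts on the chosen vector as e A, which gives its
      eigenvalue e d.\<close>
    have "\<exists>v\<in>E. \<exists>d. v \<noteq> 0 \<and> d * d = 1 \<and> A v = scale d v \<and> B v = scale (e * d) v"
    proof (cases "x + A x = 0")
      case True
      then have "A x = scale (-1) x" by (simp add: add_eq_0_iff)
      then show ?thesis using x by (intro bexI[of _ x] exI[of _ "-1"]) auto
    next
      case False
      moreover have "A (x + A x) = x + A x" by (simp add: A.add add.commute)
      moreover have "B (x + A x) = scale e (x + A x)"
        by (simp add: B.add BAx x(3) scale_right_distrib add.commute)
      moreover have "x + A x \<in> E" using x AE E by (auto intro: subspace_add)
      ultimately show ?thesis by (intro bexI[of _ "x + A x"] exI[of _ 1]) auto
    qed
    then obtain v d where v: "v \<in> E" "v \<noteq> 0" "d * d = 1" "A v = scale d v" "B v = scale (e * d) v"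
      by blast
    have "(e * d) * (e * d) = 1" using e(1) v(3) by (metis mult.assoc mult.commute mult_1)
    then have "valid_block (Lin d (e * d))" using v(3) by (simp only: valid_block.simps power2_eq_square)
    then show ?thesis using v by (intro exI[of _ "(Lin d (e * d), v)"]) (auto simp: E_def)
  qed
qed

text \<open>Among the families of valid blocks whose bases are jointly independent, choose one of
  maximal total length. If it did not span, the orthogonal complement of its span would be a nonzero
  invariant subspace containing a further block.\<close>

lemma block_decomposition:
  "\<exists>ps. (\<forall>p\<in>set ps. valid_block (fst p) \<and> spans_block p) \<and>
    ordered_basis scale (concat (map (block_basis B) ps))"
proof -
  define P where "P ps \<longleftrightarrow> (\<forall>p\<in>set ps. valid_block (fst p) \<and> spans_block p) \<and>
    distinct (concat (map (block_basis B) ps)) \<and> independent (set (concat (map (block_basis B) ps)))" for ps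
  define l where "l ps = length (concat (map (block_basis B) ps))" for ps
  obtain T where T: "finite T" "span T = UNIV" using finite_dim by blast
  have "l ps < Suc (card T)" if "P ps" for ps
  proof -
    have "card (set (concat (map (block_basis B) ps))) \<le> card T"
      using that T independent_span_bound unfolding P_def by blast
    then show ?thesis using that unfolding P_def l_def by (metis distinct_card less_Suc_eq_le)
  qed
  moreover have "P []" by (simp add: P_def independent_empty)
  ultimately obtain ps where ps: "P ps" and max: "\<And>qs. P qs \<Longrightarrow> l qs \<le> l ps"
    using ex_has_greatest_nat[of P "[]" l "Suc (card T)"] by auto
  define bs where "bs = concat (map (block_basis B) ps)"
  have inv: "A ` span (set bs) \<subseteq> span (set bs)" "B ` span (set bs) \<subseteq> span (set bs)"
  proof -
    have "A x \<in> span (set bs) \<and> B x \<in> span (set bs)" if x: "x \<in> set bs" for x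
    proof -
      obtain p where p: "p \<in> set ps" "x \<in> set (block_basis B p)" using x unfolding bs_def set_concat set_map by blast
      have "span (set (block_basis B p)) \<subseteq> span (set bs)" using p(1) by (intro span_mono) (auto simp: bs_def)
      moreover have "spans_block p" using ps p(1) by (simp add: P_def)
      ultimately show ?thesis using span_block_invariant[of p] span_base[OF p(2)] by blast
    qed
    then show "A ` span (set bs) \<subseteq> span (set bs)" "B ` span (set bs) \<subseteq> span (set bs)"
      using span_invariant[of "set bs"] by blast+
  qed
  define W where "W = {x. \<forall>w\<in>span (set bs). ip x w = 0}"
  have W: "subspace W" by (auto simp: W_def subspace_def ip_add_left ip_scale_left)
  have disj: "span (set bs) \<inter> W = {0}" by (auto simp: W_def span_zero)
  have "A x \<in> W" "B x \<in> W" if "x \<in> W" for x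
  proof -
    have "ip (A x) w = 0" "ip (B x) w = 0" if "w \<in> span (set bs)" for w
    proof -
      \<comment> \<open>A unitary involution is self-adjoint:
        \<open>ip (A x) w = ip x (A w)\<close>, and likewise for B.\<close>
      have "A w \<in> span (set bs)" "B w \<in> span (set bs)" using that inv by auto
      then show "ip (A x) w = 0" "ip (B x) w = 0"
        using \<open>x \<in> W\<close> ip_A[of x "A w"] ip_B[of x "B w"] by (auto simp: W_def)
    qed
    then show "A x \<in> W" "B x \<in> W" by (auto simp: W_def)
  qed
  note W = W this
  have "span (set bs) = UNIV"
  proof (rule ccontr)
    assume "span (set bs) \<noteq> UNIV"
    then obtain x where x: "x \<notin> span (set bs)" by blast
    obtain u where u: "u \<in> span (set bs)" "x - u \<in> W"
      using orthogonal_projection_exists[of "set bs" x] by (auto simp: W_def)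
    have "x - u \<noteq> 0" using x u(1) by auto
    then have "W \<noteq> {0}" using u(2) by blast
    then obtain p where p: "valid_block (fst p)" "spans_block p" "set (block_basis B p) \<subseteq> W"
      using block_in_invariant_subspace W by blast
    have "P (p # ps)"
      using ps p independent_append_block[OF p(2) W(1) p(3) disj]
      unfolding P_def bs_def by simp
    moreover have "block_basis B p \<noteq> []" by (cases p; cases "fst p") auto
    ultimately show False using max[of "p # ps"] by (simp add: l_def)
  qed
  then show ?thesis using ps unfolding P_def bs_def ordered_basis_def by blast
qed

end

section \<open>The joint spectrum determines the pair\<close>

text \<open>Unlike \<open>operator_mat\<close>, this makes sense for any list of vectors, so it can
  be checked on each block separately and glued by \<open>mat_acts_append\<close>.\<close>

definition mat_acts :: "(complex \<Rightarrow> 'v::ab_group_add \<Rightarrow> 'v) \<Rightarrow> 'v list \<Rightarrow> ('v \<Rightarrow> 'v) \<Rightarrow> complex mat \<Rightarrow> bool" where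
  "mat_acts scale bs f M \<longleftrightarrow> M \<in> carrier_mat (length bs) (length bs) \<and>
     (\<forall>j<length bs. f (bs ! j) = (\<Sum>i<length bs. scale (M $$ (i, j)) (bs ! i)))"

lemma sum_lessThan_add:
  fixes g :: "nat \<Rightarrow> 'a::comm_monoid_add"
  shows "(\<Sum>i<m + n. g i) = (\<Sum>i<m. g i) + (\<Sum>i<n. g (m + i))"
  by (induction n) (auto simp: add.assoc)

lemma mat_acts_append:
  assumes "vector_space scale" "mat_acts scale as f M" "mat_acts scale bs f N"
  shows "mat_acts scale (as @ bs) f
    (four_block_mat M (0\<^sub>m (dim_row M) (dim_col N)) (0\<^sub>m (dim_row N) (dim_col M)) N)"
proof -
  interpret vector_space scale by fact
  let ?F = "four_block_mat M (0\<^sub>m (dim_row M) (dim_col N)) (0\<^sub>m (dim_row N) (dim_col M)) N"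
  have M: "M \<in> carrier_mat (length as) (length as)" and N: "N \<in> carrier_mat (length bs) (length bs)"
    using assms by (auto simp: mat_acts_def)
  have "f ((as @ bs) ! j) = (\<Sum>i<length (as @ bs). scale (?F $$ (i, j)) ((as @ bs) ! i))"
    if j: "j < length as + length bs" for j
  proof (cases "j < length as")
    case True
    then show ?thesis using M N assms(2) by (simp add: sum_lessThan_add nth_append mat_acts_def)
  next
    case False
    then show ?thesis using M N assms(3) j by (simp add: sum_lessThan_add nth_append mat_acts_def)
  qed
  then show ?thesis using M N unfolding mat_acts_def by auto
qed

lemma operator_mat_eq:
  assumes "vector_space scale" "ordered_basis scale bs" "mat_acts scale bs f M"
  shows "operator_mat scale bs f = M"
proof -
  interpret vector_space scale by fact
  have bs: "distinct bs" "independent (set bs)" "span (set bs) = UNIV"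
    using assms(2) by (auto simp: ordered_basis_def)
  have "representation (set bs) (f (bs ! j)) (bs ! i) = M $$ (i, j)"
    if "i < length bs" "j < length bs" for i j
  proof -
    have "representation (set bs) (f (bs ! j)) (bs ! i) =
        (\<Sum>k<length bs. M $$ (k, j) * representation (set bs) (bs ! k) (bs ! i))"
      using assms(3) that bs by (simp add: mat_acts_def representation_sum representation_scale)
    also have "\<dots> = (\<Sum>k<length bs. if k = i then M $$ (k, j) else 0)"
      using bs that by (intro sum.cong) (auto simp: representation_basis nth_eq_iff_index_eq)
    finally show ?thesis using that by simp
  qed
  then show ?thesis using assms(3) unfolding operator_mat_def mat_acts_def by (intro eq_matI) auto
qed

lemma linear_between_bases:
  assumes "vector_space scale" "vector_space scale'" "ordered_basis scale bs"
  shows "\<exists>C. Vector_Spaces.linear scale scale' C \<and> (\<forall>i<length bs. C (bs ! i) = cs ! i)"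
proof -
  interpret vs: vector_space_pair scale scale' by (intro vector_space_pair.intro assms)
  have bs: "distinct bs" "vs.vs1.independent (set bs)" using assms(3) by (auto simp: ordered_basis_def)
  define h where "h = (\<lambda>x. cs ! inv_into {..<length bs} ((!) bs) x)"
  have "inj_on ((!) bs) {..<length bs}" using bs(1) by (auto intro: inj_on_nth)
  then have h: "h (bs ! i) = cs ! i" if "i < length bs" for i
    using that by (simp add: h_def)
  obtain C where "Vector_Spaces.linear scale scale' C" "\<forall>x\<in>set bs. C x = h x"
    using vs.linear_independent_extend[OF bs(2)] by blast
  then show ?thesis using h by (intro exI[of _ C]) auto
qed

lemma intertwines_if_same_mat:
  assumes C: "Vector_Spaces.linear scale scale' C" and f: "Vector_Spaces.linear scale scale f"
    and f': "Vector_Spaces.linear scale' scale' f'" and bs: "ordered_basis scale bs"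
    and M: "mat_acts scale bs f M" "mat_acts scale' cs f' M"
    and Cb: "\<And>i. i < length bs \<Longrightarrow> C (bs ! i) = cs ! i"
  shows "C (f x) = f' (C x)"
proof -
  interpret C: Vector_Spaces.linear scale scale' C by fact
  interpret f': Vector_Spaces.linear scale' scale' f' by fact
  have len: "length cs = length bs" using M by (auto simp: mat_acts_def)
  have "(C \<circ> f) x = (f' \<circ> C) x"
  proof (rule vector_space_pair.linear_eq_on[where B = "set bs"])
    show "vector_space_pair scale scale'" by unfold_locales
    show "Vector_Spaces.linear scale scale' (C \<circ> f)" "Vector_Spaces.linear scale scale' (f' \<circ> C)"
      using C f f' Vector_Spaces.linear_compose by blast+
    show "x \<in> C.vs1.span (set bs)" using bs by (simp add: ordered_basis_def)
    fix b assume "b \<in> set bs"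
    then obtain j where j: "j < length bs" "b = bs ! j" by (auto simp: in_set_conv_nth)
    have "C (f b) = (\<Sum>i<length bs. scale' (M $$ (i, j)) (cs ! i))"
      using M(1) j Cb by (simp add: mat_acts_def C.sum C.scale)
    also have "\<dots> = f' (C b)" using M(2) j Cb len by (simp add: mat_acts_def)
    finally show "(C \<circ> f) b = (f' \<circ> C) b" by simp
  qed
  then show ?thesis by simp
qed

text \<open>C matches the two bases position by position and D is its inverse. Equal matrices in
  matched bases mean that C carries f to f' and g to g'.\<close>

lemma intertwiner_exists:
  assumes lin: "Vector_Spaces.linear scale scale f" "Vector_Spaces.linear scale scale g"
      "Vector_Spaces.linear scale' scale' f'" "Vector_Spaces.linear scale' scale' g'"
    and bs: "ordered_basis scale bs" and cs: "ordered_basis scale' cs"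
    and M: "mat_acts scale bs f M" "mat_acts scale' cs f' M"
    and N: "mat_acts scale bs g N" "mat_acts scale' cs g' N"
  shows "\<exists>C. Vector_Spaces.linear scale scale' C \<and> bij C \<and>
    (\<forall>x. C (f x) = f' (C x)) \<and> (\<forall>x. C (g x) = g' (C x))"
proof -
  interpret f: Vector_Spaces.linear scale scale f by fact
  interpret f': Vector_Spaces.linear scale' scale' f' by fact
  have vs: "vector_space scale" "vector_space scale'" by unfold_locales
  have len: "length cs = length bs" using M by (auto simp: mat_acts_def)
  obtain C where C: "Vector_Spaces.linear scale scale' C" "\<And>i. i < length bs \<Longrightarrow> C (bs ! i) = cs ! i"
    using linear_between_bases[OF vs bs] by blast
  obtain D where D: "Vector_Spaces.linear scale' scale D" "\<And>i. i < length cs \<Longrightarrow> D (cs ! i) = bs ! i"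
    using linear_between_bases[OF vs(2,1) cs] by blast
  have "(D \<circ> C) x = id x" for x
  proof (rule vector_space_pair.linear_eq_on[where ?s1.0 = scale and ?s2.0 = scale
        and f = "D \<circ> C" and g = id and B = "set bs"])
    show "vector_space_pair scale scale" by unfold_locales
    show "Vector_Spaces.linear scale scale (D \<circ> C)" by (rule Vector_Spaces.linear_compose[OF C(1) D(1)])
    show "Vector_Spaces.linear scale scale id" by (rule f.vs1.linear_id)
  qed (use bs C D len in \<open>auto simp: ordered_basis_def in_set_conv_nth\<close>)
  moreover have "(C \<circ> D) x = id x" for x
  proof (rule vector_space_pair.linear_eq_on[where ?s1.0 = scale' and ?s2.0 = scale'
        and f = "C \<circ> D" and g = id and B = "set cs"])
    show "vector_space_pair scale' scale'" by unfold_locales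
    show "Vector_Spaces.linear scale' scale' (C \<circ> D)" by (rule Vector_Spaces.linear_compose[OF D(1) C(1)])
    show "Vector_Spaces.linear scale' scale' id" by (rule f'.vs1.linear_id)
  qed (use cs C D len in \<open>auto simp: ordered_basis_def in_set_conv_nth\<close>)
  ultimately have "bij C" by (intro o_bij[of D C]) auto
  then show ?thesis
    using C intertwines_if_same_mat[OF C(1) lin(1,3) bs M C(2)]
      intertwines_if_same_mat[OF C(1) lin(2,4) bs N C(2)] by blast
qed

section \<open>Block-diagonal form of an involution pair\<close>

context involution_pair
begin

lemma mat_acts_block:
  assumes "spans_block p"
  shows "mat_acts scale (block_basis B p) A (block_mat1 (fst p))"
    "mat_acts scale (block_basis B p) B (block_mat2 (fst p))"
proof -
  obtain t v where p: "p = (t, v)" by (cases p)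
  have "mat_acts scale (block_basis B p) A (block_mat1 (fst p)) \<and>
    mat_acts scale (block_basis B p) B (block_mat2 (fst p))"
    using assms unfolding p
    by (cases t) (auto simp: mat_acts_def mat_of_rows_list_def numeral_2_eq_2 less_Suc_eq intro!: carrier_matI)
  then show "mat_acts scale (block_basis B p) A (block_mat1 (fst p))"
    "mat_acts scale (block_basis B p) B (block_mat2 (fst p))" by auto
qed

lemma mat_acts_blocks:
  assumes "\<forall>p\<in>set ps. spans_block p"
  shows "mat_acts scale (concat (map (block_basis B) ps)) A (diag_block_mat (map block_mat1 (map fst ps)))"
    "mat_acts scale (concat (map (block_basis B) ps)) B (diag_block_mat (map block_mat2 (map fst ps)))"
  using assms
proof (induction ps)
  case Nil
  { case 1 show ?case by (simp add: mat_acts_def) }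
  { case 2 show ?case by (simp add: mat_acts_def) }
next
  case (Cons p ps)
  { case 1
    then show ?case using mat_acts_append[OF vector_space_axioms mat_acts_block(1) Cons.IH(1)]
      by (simp add: Let_def) }
  { case 2
    then show ?case using mat_acts_append[OF vector_space_axioms mat_acts_block(2) Cons.IH(2)]
      by (simp add: Let_def) }
qed

lemma joint_char_poly_blocks:
  assumes "\<forall>p\<in>set ps. spans_block p" "ordered_basis scale (concat (map (block_basis B) ps))"
  shows "joint_char_poly scale A B = prod_list (map block_poly (map fst ps))"
  unfolding joint_char_poly_eq[OF A.linear_axioms B.linear_axioms assms(2)]
    operator_mat_eq[OF vector_space_axioms assms(2) mat_acts_blocks(1)[OF assms(1)]]
    operator_mat_eq[OF vector_space_axioms assms(2) mat_acts_blocks(2)[OF assms(1)]]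
  by (rule pencil_det_diag_block_mat)

end

section \<open>Equal spectra and irreducible pairs\<close>

lemma mset_concat_map: "mset (concat (map f xs)) = (\<Sum>x\<in>#mset xs. mset (f x))"
  by (induction xs) auto

lemma involution_pairs_equivalent:
  assumes "involution_pair scale ip A B" "involution_pair scale' ip' A' B'"
    and eq: "proper_joint_spectrum scale A B = proper_joint_spectrum scale' A' B'"
  shows "\<exists>C. Vector_Spaces.linear scale scale' C \<and> bij C \<and>
    (\<forall>x. C (A x) = A' (C x)) \<and> (\<forall>x. C (B x) = B' (C x))"
proof -
  interpret P: involution_pair scale ip A B by fact
  interpret P': involution_pair scale' ip' A' B' by fact
  obtain ps where ps: "\<forall>p\<in>set ps. valid_block (fst p) \<and> P.spans_block p"
    "ordered_basis scale (concat (map (block_basis B) ps))"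
    using P.block_decomposition by blast
  obtain qs where qs: "\<forall>p\<in>set qs. valid_block (fst p) \<and> P'.spans_block p"
    "ordered_basis scale' (concat (map (block_basis B') qs))"
    using P'.block_decomposition by blast
  have "mset (map fst ps) = mset (map fst qs)"
  proof (rule mset_blocks_eq)
    show "PIdl\<^bsub>plane_ring\<^esub> (prod_list (map block_poly (map fst ps))) =
        PIdl\<^bsub>plane_ring\<^esub> (prod_list (map block_poly (map fst qs)))"
      using eq P.joint_char_poly_blocks[of ps] P'.joint_char_poly_blocks[of qs] ps qs
      unfolding proper_joint_spectrum_def by simp
  qed (use ps qs in auto)
  \<comment> \<open>The second decomposition is permuted so that its blocks come in the order of the
    first. Both pairs are then given by the same block-diagonal matrices.\<close>
  moreover have "list_all2 (\<lambda>t q. t = fst q) (map fst qs) qs"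
    by (simp add: list_all2_conv_all_nth)
  ultimately obtain rs where "list_all2 (\<lambda>t q. t = fst q) (map fst ps) rs" and rs: "mset rs = mset qs"
    using list_all2_reorder_left_invariance by blast
  then have fst: "map fst rs = map fst ps" by (auto simp: list_all2_conv_all_nth intro: nth_equalityI)
  have "mset (concat (map (block_basis B') rs)) = mset (concat (map (block_basis B') qs))"
    unfolding mset_concat_map rs ..
  then have rs_basis: "ordered_basis scale' (concat (map (block_basis B') rs))"
    using qs(2) unfolding ordered_basis_def
    by (metis mset_eq_imp_distinct_iff mset_eq_setD)
  have rs_spans: "\<forall>p\<in>set rs. P'.spans_block p" using qs(1) mset_eq_setD[OF rs] by auto
  have ps_spans: "\<forall>p\<in>set ps. P.spans_block p" using ps(1) by auto
  show ?thesis
    by (rule intertwiner_exists[OF P.A.linear_axioms P.B.linear_axioms P'.A.linear_axioms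
          P'.B.linear_axioms ps(2) rs_basis P.mat_acts_blocks(1)[OF ps_spans]
          P'.mat_acts_blocks(1)[OF rs_spans, unfolded fst] P.mat_acts_blocks(2)[OF ps_spans]
          P'.mat_acts_blocks(2)[OF rs_spans, unfolded fst]])
qed

text \<open>Any single block of a decomposition spans a nonzero invariant subspace, hence
  everything. The joint polynomial is then that of one valid block.\<close>

lemma (in involution_pair) irreducible_joint_char_poly:
  assumes "x \<noteq> (0 :: 'v)"
    and irr: "\<And>W. subspace W \<Longrightarrow> A ` W \<subseteq> W \<Longrightarrow> B ` W \<subseteq> W \<Longrightarrow> W = {0} \<or> W = UNIV"
  shows "irreducible (joint_char_poly scale A B)"
proof -
  obtain ps where ps: "\<forall>p\<in>set ps. valid_block (fst p) \<and> spans_block p"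
    "ordered_basis scale (concat (map (block_basis B) ps))"
    using block_decomposition by blast
  have "ps \<noteq> []" using ps(2) assms(1) by (auto simp: ordered_basis_def)
  then obtain p where p: "valid_block (fst p)" "spans_block p"
    using ps(1) by (meson list.set_sel(1))
  \<comment> \<open>Appending to the empty list inside the whole space leaves the independence of
    the block basis itself.\<close>
  have bas: "distinct (block_basis B p)" "independent (set (block_basis B p))"
    using independent_append_block[OF p(2), of UNIV "[]"] by (auto simp: independent_empty)
  have "snd p \<in> set (block_basis B p)" "snd p \<noteq> 0"
    using p(2) by (cases p; cases "fst p"; auto)+
  then have "span (set (block_basis B p)) \<noteq> {0}" using span_base by blast
  then have "span (set (block_basis B p)) = UNIV"
    using irr[OF subspace_span] span_block_invariant[OF p(2)] by blast
  then have "ordered_basis scale (concat (map (block_basis B) [p]))"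
    using bas by (simp add: ordered_basis_def)
  then have "joint_char_poly scale A B = block_poly (fst p)"
    using joint_char_poly_blocks[of "[p]"] p(2) by simp
  then show ?thesis using irreducible_block_poly[OF p(1)] by simp
qed

section \<open>Representations of the Coxeter group\<close>

lemma coxeter_group_generators:
  assumes "coxeter_group_I n G g1 g2"
  shows "group G" "g1 \<in> carrier G" "g2 \<in> carrier G"
    "g1 \<otimes>\<^bsub>G\<^esub> g1 = \<one>\<^bsub>G\<^esub>" "g2 \<otimes>\<^bsub>G\<^esub> g2 = \<one>\<^bsub>G\<^esub>"
proof -
  let ?\<gamma> = "case_dihedral_gen g1 g2"
  have *: "group G" "range ?\<gamma> \<subseteq> carrier G"
    "\<And>w. pres_eq (dihedral_relators n) w [] \<Longrightarrow> word_value G ?\<gamma> w = \<one>\<^bsub>G\<^esub>"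
    using assms unfolding coxeter_group_I_def presented_by_def by auto
  interpret group G by fact
  show "group G" by fact
  show g: "g1 \<in> carrier G" "g2 \<in> carrier G"
    using *(2) rangeI[of ?\<gamma> S1] rangeI[of ?\<gamma> S2] by auto
  have "word_value G ?\<gamma> [(s, True), (s, True)] = \<one>\<^bsub>G\<^esub>" for s
    by (rule *(3), rule pres_relator) (cases s; simp add: dihedral_relators_def)
  from this[of S1] this[of S2] show "g1 \<otimes>\<^bsub>G\<^esub> g1 = \<one>\<^bsub>G\<^esub>" "g2 \<otimes>\<^bsub>G\<^esub> g2 = \<one>\<^bsub>G\<^esub>"
    using g by auto
qed

text \<open>Every element is the value of a word, and a formal inverse letter has the same value as
  its generator because the generators are involutions.\<close>

lemma coxeter_group_induct [consumes 2, case_names one mult]: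
  assumes G: "coxeter_group_I n G g1 g2" and x: "x \<in> carrier G"
    and one: "P \<one>\<^bsub>G\<^esub>"
    and mult: "\<And>g y. g \<in> {g1, g2} \<Longrightarrow> y \<in> carrier G \<Longrightarrow> P y \<Longrightarrow> P (g \<otimes>\<^bsub>G\<^esub> y)"
  shows "P x"
proof -
  let ?\<gamma> = "case_dihedral_gen g1 g2"
  note gen = coxeter_group_generators[OF G]
  interpret group G by (rule gen(1))
  have inv: "inv\<^bsub>G\<^esub> g1 = g1" "inv\<^bsub>G\<^esub> g2 = g2" using gen inv_equality by auto
  have "word_value G ?\<gamma> w \<in> carrier G \<and> P (word_value G ?\<gamma> w)" for w
  proof (induction w)
    case Nil
    then show ?case using one by simp
  next
    case (Cons l w)
    have "(if snd l then ?\<gamma> (fst l) else inv\<^bsub>G\<^esub> (?\<gamma> (fst l))) \<in> {g1, g2}"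
      by (cases "fst l") (auto simp: inv)
    then show ?case using Cons gen mult by auto
  qed
  moreover obtain w where "x = word_value G ?\<gamma> w"
    using G x unfolding coxeter_group_I_def presented_by_def by blast
  ultimately show ?thesis by blast
qed

text \<open>By multiplicativity the image of the unit is idempotent, and an injective idempotent map
  is the identity.\<close>

lemma unitary_rep_one:
  assumes "group G" "unitary_rep G scale ip \<rho>"
  shows "\<rho> \<one>\<^bsub>G\<^esub> = id"
proof -
  interpret group G by fact
  have hom: "\<rho> \<in> hom G (GL scale)" using assms(2) by (simp add: unitary_rep_def)
  have "\<rho> \<one>\<^bsub>G\<^esub> \<circ> \<rho> \<one>\<^bsub>G\<^esub> = \<rho> \<one>\<^bsub>G\<^esub>"
    using hom_mult[OF hom one_closed one_closed] by (simp add: GL_def)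
  moreover have "inj (\<rho> \<one>\<^bsub>G\<^esub>)"
    using hom_in_carrier[OF hom one_closed] by (simp add: GL_def bij_is_inj)
  ultimately show ?thesis by (metis comp_apply eq_id_iff injD)
qed

lemma unitary_rep_mult:
  assumes "unitary_rep G scale ip \<rho>" "x \<in> carrier G" "y \<in> carrier G"
  shows "\<rho> (x \<otimes>\<^bsub>G\<^esub> y) = \<rho> x \<circ> \<rho> y"
  using assms hom_mult[of \<rho> G "GL scale" x y] by (simp add: unitary_rep_def GL_def)

lemma involution_pair_unitary_rep:
  assumes G: "coxeter_group_I n G g1 g2" and rep: "unitary_rep G scale ip \<rho>"
  shows "involution_pair scale ip (\<rho> g1) (\<rho> g2)"
proof -
  note gen = coxeter_group_generators[OF G]
  interpret fd_hilbert_space scale ip using rep by (simp add: unitary_rep_def)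
  have lin: "Vector_Spaces.linear scale scale (\<rho> g)" if "g \<in> carrier G" for g
    using rep hom_in_carrier[of \<rho> G "GL scale" g] that by (auto simp: unitary_rep_def GL_def)
  have "\<rho> g1 \<circ> \<rho> g1 = id" "\<rho> g2 \<circ> \<rho> g2 = id"
    using unitary_rep_mult[OF rep, symmetric] unitary_rep_one[OF gen(1) rep] gen by auto
  then have "\<rho> g1 (\<rho> g1 x) = x" "\<rho> g2 (\<rho> g2 x) = x" for x
    by (metis comp_apply id_apply)+
  then show ?thesis
    using rep gen by (intro involution_pair.intro involution_pair_axioms.intro lin fd_hilbert_space_axioms)
      (auto simp: unitary_rep_def)
qed

theorem theorem5p20:
  fixes n :: enat
    and G :: "('g, 'm) monoid_scheme" and g1 g2 :: 'g
    and scale :: "complex \<Rightarrow> 'v::ab_group_add \<Rightarrow> 'v"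
    and ip :: "'v \<Rightarrow> 'v \<Rightarrow> complex"
    and \<rho> :: "'g \<Rightarrow> 'v \<Rightarrow> 'v"
  assumes "2 \<le> n"
    and "coxeter_group_I n G g1 g2"
    and "unitary_rep G scale ip \<rho>"
  shows "(\<forall>(scale' :: complex \<Rightarrow> 'w::ab_group_add \<Rightarrow> 'w) ip' \<rho>'.
            unitary_rep G scale' ip' \<rho>' \<and>
            proper_joint_spectrum scale (\<rho> g1) (\<rho> g2) =
              proper_joint_spectrum scale' (\<rho>' g1) (\<rho>' g2) \<longrightarrow>
            equivalent_reps G scale \<rho> scale' \<rho>')
       \<and> (irreducible_rep G scale \<rho> \<longrightarrow>
            reduced_subscheme (proper_joint_spectrum scale (\<rho> g1) (\<rho> g2)) \<and>
            irreducible_subscheme (proper_joint_spectrum scale (\<rho> g1) (\<rho> g2)))"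
proof (intro conjI[of "All _"] allI impI)
  note gen = coxeter_group_generators[OF assms(2)]
  note pair = involution_pair_unitary_rep[OF assms(2)]
  fix scale' :: "complex \<Rightarrow> 'w \<Rightarrow> 'w" and ip' \<rho>'
  assume asm: "unitary_rep G scale' ip' \<rho>' \<and> proper_joint_spectrum scale (\<rho> g1) (\<rho> g2) =
    proper_joint_spectrum scale' (\<rho>' g1) (\<rho>' g2)"
  then have rep': "unitary_rep G scale' ip' \<rho>'" by simp
  obtain C where C: "Vector_Spaces.linear scale scale' C" "bij C"
    "\<And>x. C (\<rho> g1 x) = \<rho>' g1 (C x)" "\<And>x. C (\<rho> g2 x) = \<rho>' g2 (C x)"
    using involution_pairs_equivalent[OF pair[OF assms(3)] pair[OF rep']] asm by blast
  have "\<rho>' w = C \<circ> \<rho> w \<circ> inv_into UNIV C" if "w \<in> carrier G" for w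
  proof -
    \<comment> \<open>Intertwining the two generators extends to all of G by induction along
      words.\<close>
    have "\<forall>x. C (\<rho> w x) = \<rho>' w (C x)"
      using assms(2) that
    proof (induction w rule: coxeter_group_induct)
      case one
      then show ?case using unitary_rep_one[OF gen(1)] assms(3) rep' by (metis id_apply)
    next
      case (mult g y)
      then show ?case
        using C gen unitary_rep_mult[OF assms(3), of g y] unitary_rep_mult[OF rep', of g y] by auto
    qed
    then show ?thesis using C(2) by (auto simp: fun_eq_iff bij_is_surj surj_f_inv_f)
  qed
  then show "equivalent_reps G scale \<rho> scale' \<rho>'"
    unfolding equivalent_reps_def using C(1,2) by blast
next
  note gen = coxeter_group_generators[OF assms(2)]
  assume irr: "irreducible_rep G scale \<rho>"
  interpret involution_pair scale ip "\<rho> g1" "\<rho> g2"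
    by (rule involution_pair_unitary_rep[OF assms(2,3)])
  have "irreducible (joint_char_poly scale (\<rho> g1) (\<rho> g2))"
  proof -
    obtain x :: 'v where x: "x \<noteq> 0" using irr by (auto simp: irreducible_rep_def)
    show ?thesis
    proof (rule irreducible_joint_char_poly[OF x])
      fix W assume W: "subspace W" "\<rho> g1 ` W \<subseteq> W" "\<rho> g2 ` W \<subseteq> W"
      have "\<rho> w ` W \<subseteq> W" if "w \<in> carrier G" for w
        using assms(2) that
      proof (induction w rule: coxeter_group_induct)
        case one
        then show ?case using unitary_rep_one[OF gen(1) assms(3)] by simp
      next
        case (mult g y)
        then have "\<rho> (g \<otimes>\<^bsub>G\<^esub> y) = \<rho> g \<circ> \<rho> y"
          using gen by (intro unitary_rep_mult[OF assms(3)]) auto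
        moreover have "\<rho> g ` W \<subseteq> W" using mult(1) W by auto
        ultimately show ?case using mult(3) by (simp add: image_comp[symmetric]) blast
      qed
      then show "W = {0} \<or> W = UNIV" using irr W(1) unfolding irreducible_rep_def by blast
    qed
  qed
  then show "reduced_subscheme (proper_joint_spectrum scale (\<rho> g1) (\<rho> g2)) \<and>
      irreducible_subscheme (proper_joint_spectrum scale (\<rho> g1) (\<rho> g2))"
    unfolding proper_joint_spectrum_def by (intro conjI integral_hypersurface)
qed

end
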